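(* Let $\mathbf{P}=\mathbf{G}_L$ and $\mathbf{Q}=\tau(\mathbf{C}_L)\mathbf{G}_L^{\mathrm T}$. Let $1\le k\le n\leq m_L\leq J$ and let $0\le l_0,\dots,l_{n-1}\le L-1$ be distinct integers. If $$\mathrm{rank}\Big(\sum_{i=0}^{n-1} a_i\mathbf{P}\mathbf{C}_L^{l_i}\mathbf{Q}\Big)=J\quad\text{for all } [a_0,\ldots,a_{n-1}]\in\mathbb{F}_q^n\setminus\{\mathbf{0}\},\qquad ( * )$$ then the circular-shift-based rank-metric code $\mathcal{C}=\mathcal{C}(\mathbf P,\mathbf Q;l_0,\dots,l_{n-1})\subseteq\mathbb{F}_q^{J\times n}$ is a $(J\times n,q^{Jk},d)$ MRD code, that is, it has $q^{Jk}$ elements and minimum rank distance $d=n-k+1$. In particular, for every constant $0\le c\le L-1$, the choice $l_j=j+c \bmod L$, $0\le j\le n-1$, satisfies $( * )$.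
   Context: Setting. $q$ is a prime, $L$ is a positive integer with $\gcd(q,L)=1$, $m_L$ is the multiplicative order of $q$ modulo $L$, $\mathcal{J}=\{j:1\le j\le L-1,\ \gcd(j,L)=1\}$, $J=|\mathcal{J}|$, and $m_L\le J$ (automatic for $L\ge 2$). $L_{\mathbb{F}_q}=L \bmod q$ is regarded as a nonzero element of $\mathbb{F}_q$. $\beta\in\mathbb{F}_{q^{m_L}}$ is a primitive $L$-th root of unity. $\mathbf{C}_L=\begin{bmatrix}\mathbf{0}&\mathbf{I}_{L-1}\\1&\mathbf{0}\end{bmatrix}$ is the $L\times L$ cyclic permutation matrix over $\mathbb{F}_q$. $\mathbf{V}_L=[\beta^{ij}]_{0\le i,j\le L-1}$ and $\widetilde{\mathbf{V}}_L=[\beta^{-ij}]_{0\le i,j\le L-1}$. For column vectors $\mathbf{x}_j$, $[\mathbf{x}_j]_{j\in\mathcal{J}}$ denotes their juxtaposition in increasing order of $j$ (similarly for $j\notin\mathcal J$, meaning $0\le j\le L-1$, $j\notin\mathcal{J}$). $\tau(x)=\prod_{0\le j\le L-1,\,j\notin\mathcal{J}}(x-\beta^j)$, a polynomial of degree $L-J$ with coefficients in $\mathbb{F}_q$, and $\tau(\mathbf{C}_L)$ is its evaluation at $\mathbf{C}_L$. $\mathbf{U}=[\mathbf{u}_j]_{0\le j\le L-1}$ and $\mathbf{U}'=[\mathbf{u}'_j]_{0\le j\le L-1}$ are matrices in $\mathbb{F}_{q^{m_L}}^{J\times L}$ (columns indexed from $0$) satisfying: $\mathrm{rank}([\mathbf{u}_j]_{j\in\mathcal{J}})=J$;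 $[\mathbf{u}'_j]_{j\in\mathcal{J}}^{\mathrm T}=L_{\mathbb{F}_q}^{-1}[\mathbf{u}_j]_{j\in\mathcal{J}}^{-1}$; and $[\mathbf{u}_j]_{j\notin\mathcal{J}}=\mathbf{0}$ or $[\mathbf{u}'_j]_{j\notin\mathcal{J}}=\mathbf{0}$. Put $\mathbf{G}_L=\mathbf{U}\widetilde{\mathbf{V}}_L$ ($J\times L$) and $\mathbf{H}_L=\mathbf{V}_L\mathbf{U}'^{\mathrm T}$ ($L\times J$). It is assumed that $\mathbf{U},\mathbf{U}'$ are such that $\mathbf{G}_L$ and $\mathbf{H}_L$ have all entries in $\mathbb{F}_q$. Circular-shift-based rank-metric code. For $\mathbf{P}\in\mathbb{F}_q^{J\times L}$, $\mathbf{Q}\in\mathbb{F}_q^{L\times J}$ and distinct $0\le l_0,\dots,l_{n-1}\le L-1$, $\mathcal{C}(\mathbf P,\mathbf Q;l_0,\dots,l_{n-1})$ is the set of all matrices $[\mathbf{c}_0^{\mathrm T}\ \mathbf{c}_1^{\mathrm T}\ \cdots\ \mathbf{c}_{n-1}^{\mathrm T}]\in\mathbb{F}_q^{J\times n}$ with $\mathbf{c}_i=\sum_{s=0}^{k-1}\mathbf{m}_s\mathbf{P}\mathbf{C}_L^{q^sl_i}\mathbf{Q}$, as $(\mathbf{m}_0,\dots,\mathbf{m}_{k-1})$ ranges over $k$-tuples of row vectors in $\mathbb{F}_q^J$. The rank distance of two matrices is the rank of their difference; the minimum rank distance of a code is the minimum over pairs of distinct codewords. A code $\mathcal{M}\subseteq\mathbb{F}_q^{N\times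 n}$ ($n\le N$) with minimum rank distance $d$ is MRD if $|\mathcal{M}|=q^{N(n-d+1)}$. *)

theory Defs
  imports
    "Jordan_Normal_Form.DL_Rank"
    "Jordan_Normal_Form.DL_Submatrix"
    "Jordan_Normal_Form.Gauss_Jordan_Elimination"
    "Jordan_Normal_Form.Ring_Hom_Matrix"
    "HOL-Number_Theory.Number_Theory"
    "HOL-Library.Cardinality"
begin

text \<open>
  The field with \<open>q\<close> elements is a type \<open>'f\<close>; its extension of degree \<open>m\<close> is a type \<open>'e\<close>
  together with a field homomorphism \<open>\<iota> :: 'f \<Rightarrow> 'e\<close>. An object over \<open>'e\<close> with entries in the
  small field is one in the image of \<open>\<iota>\<close>.
\<close>

definition mat_rank :: "'a::field mat \<Rightarrow> nat" where
  "mat_rank A = vec_space.rank (dim_row A) A"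

definition mat_sum :: "nat \<Rightarrow> nat \<Rightarrow> ('i \<Rightarrow> 'a::comm_monoid_add mat) \<Rightarrow> 'i set \<Rightarrow> 'a mat" where
  "mat_sum nr nc F I = mat nr nc (\<lambda>(r, c). \<Sum>i\<in>I. F i $$ (r, c))"

definition poly_mat :: "'a::comm_ring_1 poly \<Rightarrow> 'a mat \<Rightarrow> 'a mat" where
  "poly_mat p A = mat_sum (dim_row A) (dim_row A)
     (\<lambda>i. Polynomial.coeff p i \<cdot>\<^sub>m (A ^\<^sub>m i)) {..Polynomial.degree p}"

definition is_primitive_root_of_unity :: "nat \<Rightarrow> 'a::field \<Rightarrow> bool" where
  "is_primitive_root_of_unity L \<beta> \<longleftrightarrow> \<beta> ^ L = 1 \<and> (\<forall>j. 0 < j \<and> j < L \<longrightarrow> \<beta> ^ j \<noteq> 1)"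

definition cyclic_perm_mat :: "nat \<Rightarrow> 'a::field mat" where
  "cyclic_perm_mat L =
     four_block_mat (0\<^sub>m (L - 1) 1) (1\<^sub>m (L - 1)) (1\<^sub>m 1) (0\<^sub>m 1 (L - 1))"

text \<open>For \<open>L = 1\<close> this set is empty, so its cardinality is not Euler's totient there.\<close>

definition unit_indices :: "nat \<Rightarrow> nat set" where
  "unit_indices L = {j. 1 \<le> j \<and> j \<le> L - 1 \<and> coprime j L}"

definition vandermonde :: "nat \<Rightarrow> 'a::field \<Rightarrow> 'a mat" where
  "vandermonde L \<beta> = mat L L (\<lambda>(i, j). \<beta> ^ (i * j))"

definition vandermonde_neg :: "nat \<Rightarrow> 'a::field \<Rightarrow> 'a mat" where
  "vandermonde_neg L \<beta> = mat L L (\<lambda>(i, j). inverse (\<beta> ^ (i * j)))"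

definition tau_ext :: "nat \<Rightarrow> 'e::field \<Rightarrow> 'e poly" where
  "tau_ext L \<beta> = (\<Prod>j\<in>{..<L} - unit_indices L. [:- (\<beta> ^ j), 1:])"

text \<open>
  The same polynomial over the small field. Its coefficients do lie in the image of the injective
  map \<open>\<iota>\<close>, so pulling them back by \<open>inv_into UNIV \<iota>\<close> loses nothing.
\<close>

definition tau :: "('f::field \<Rightarrow> 'e::field) \<Rightarrow> nat \<Rightarrow> 'e \<Rightarrow> 'f poly" where
  "tau \<iota> L \<beta> = map_poly (inv_into UNIV \<iota>) (tau_ext L \<beta>)"

text \<open>
  Row vectors are represented by elements of type \<open>vec\<close>, and the codewords have the transposes of
  the row vectors \<open>c\<^sub>i\<close> as columns; the column belonging to \<open>m\<^sub>s M\<close> is \<open>M\<^sup>T m\<^sub>s\<^sup>T\<close>.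
\<close>

definition cs_encode ::
  "nat \<Rightarrow> nat \<Rightarrow> nat \<Rightarrow> 'f::field mat \<Rightarrow> 'f mat \<Rightarrow> (nat \<Rightarrow> nat) \<Rightarrow> (nat \<Rightarrow> 'f vec) \<Rightarrow> 'f mat" where
  "cs_encode q k n P Q l m = mat_of_cols (dim_col Q) (map (\<lambda>i.
     finsum_vec TYPE('f) (dim_col Q)
       (\<lambda>s. transpose_mat (P * cyclic_perm_mat (dim_col P) ^\<^sub>m (q ^ s * l i) * Q) *\<^sub>v m s) {..<k})
     [0..<n])"

definition cs_code ::
  "nat \<Rightarrow> nat \<Rightarrow> nat \<Rightarrow> 'f::field mat \<Rightarrow> 'f mat \<Rightarrow> (nat \<Rightarrow> nat) \<Rightarrow> 'f mat set" where
  "cs_code q k n P Q l =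
     {cs_encode q k n P Q l m | m. \<forall>s<k. m s \<in> carrier_vec (dim_row P)}"

definition rank_dist :: "'a::field mat \<Rightarrow> 'a mat \<Rightarrow> nat" where
  "rank_dist A B = mat_rank (A - B)"

text \<open>A relation rather than a function: codes with fewer than two elements have no minimum
  distance.\<close>

definition has_min_rank_dist :: "'a::field mat set \<Rightarrow> nat \<Rightarrow> bool" where
  "has_min_rank_dist M d \<longleftrightarrow>
     (\<exists>A\<in>M. \<exists>B\<in>M. A \<noteq> B \<and> rank_dist A B = d) \<and>
     (\<forall>A\<in>M. \<forall>B\<in>M. A \<noteq> B \<longrightarrow> d \<le> rank_dist A B)"

text \<open>The subtraction does not truncate, as \<open>d \<le> n\<close> whenever the other conditions hold.\<close>

definition is_MRD :: "nat \<Rightarrow> nat \<Rightarrow> 'a::{field, finite} mat set \<Rightarrow> nat \<Rightarrow> bool" where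
  "is_MRD N n M d \<longleftrightarrow> n \<le> N \<and> M \<subseteq> carrier_mat N n \<and> has_min_rank_dist M d \<and>
     card M = CARD('a) ^ (N * (n - d + 1))"

definition full_rank_combinations ::
  "nat \<Rightarrow> 'f::field mat \<Rightarrow> 'f mat \<Rightarrow> (nat \<Rightarrow> nat) \<Rightarrow> bool" where
  "full_rank_combinations n P Q l \<longleftrightarrow>
     (\<forall>a\<in>carrier_vec n. a \<noteq> 0\<^sub>v n \<longrightarrow>
        mat_rank (mat_sum (dim_row P) (dim_col Q)
          (\<lambda>i. (a $ i) \<cdot>\<^sub>m (P * cyclic_perm_mat (dim_col P) ^\<^sub>m l i * Q)) {..<n}) = dim_row P)"

end

theory Submission
  imports Defs "Jordan_Normal_Form.Char_Poly"
begin

text \<open>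
  Over the extension field the Vandermonde matrix of \<open>\<beta>\<close> diagonalises the cyclic permutation matrix,
  and \<open>\<tau>\<close> vanishes at \<open>\<beta>\<^sup>j\<close> unless \<open>j\<close> is a unit modulo \<open>L\<close>. So \<open>P C\<^sup>l Q = A D\<^sup>l B\<close> for fixed invertible
  matrices \<open>A\<close>, \<open>B\<close> and \<open>D = diag(\<epsilon>\<^sub>t)\<close>, where \<open>\<epsilon>\<^sub>t\<close> runs through the \<open>\<beta>\<^sup>j\<close> with \<open>j\<close> a unit. The full rank
  condition then says that for every \<open>t\<close> the powers \<open>\<epsilon>\<^sub>t\<close> to the \<open>l\<^sub>i\<close> are linearly independent over
  the small field, and, up to multiplication by \<open>A\<close> and \<open>B\<close>, each row of a codeword is a codeword of a
  Gabidulin code. If the message is nonzero, one of these rows comes from a nonzero linearized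
  polynomial of \<open>q\<close>-degree less than \<open>k\<close>. It has at most \<open>q ^ (k - 1)\<close> roots, so this bounds the kernel
  of the codeword. Ranks are compared with kernels by counting, since a matrix of rank \<open>r\<close> has \<open>q ^ r\<close>
  images.
\<close>

subsection \<open>Finite fields of prime cardinality\<close>

lemma one_less_CARD_field: "1 < CARD('a::{field, finite})"
  using card_mono[of "UNIV :: 'a set" "{0, 1}"] by simp

lemma of_nat_power_CHAR:
  assumes "prime CHAR('a::comm_semiring_1)"
  shows "(of_nat i :: 'a) ^ CHAR('a) = of_nat i"
  using assms by (induction i) (auto simp: freshmans_dream power_0_left)

lemma CHAR_eq_prime_CARD:
  assumes "prime CARD('a::{field, finite})"
  shows "CHAR('a) = CARD('a)"
  using assms CHAR_dvd_CARD[where ?'a = 'a] CHAR_not_1[where ?'a = 'a]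
  by (metis One_nat_def prime_nat_iff)

text \<open>As the characteristic equals the prime cardinality, the images of the naturals below it
  are distinct and exhaust the field; freshman's dream shows that the power map fixes each of
  them.\<close>

lemma power_prime_CARD:
  fixes x :: "'a::{field, finite}"
  assumes "prime CARD('a)"
  shows "x ^ CARD('a) = x"
proof -
  have inj: "inj_on (of_nat :: nat \<Rightarrow> 'a) {..<CARD('a)}"
  proof (rule linorder_inj_onI)
    fix i j assume ij: "i < j" "i \<in> {..<CARD('a)}" "j \<in> {..<CARD('a)}"
    hence "\<not> CHAR('a) dvd j - i"
      by (simp add: CHAR_eq_prime_CARD[OF assms] nat_dvd_not_less)
    thus "(of_nat i :: 'a) \<noteq> of_nat j"
      using of_nat_eq_iff_char_dvd[OF \<open>i < j\<close>] by blast
  qed auto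
  have "of_nat ` {..<CARD('a)} = (UNIV :: 'a set)"
    by (rule card_subset_eq) (simp_all add: card_image[OF inj])
  then obtain i where "x = of_nat i"
    by blast
  thus ?thesis
    using of_nat_power_CHAR[where ?'a = 'a] assms by (simp add: CHAR_eq_prime_CARD[OF assms])
qed

lemma CHAR_field_hom:
  assumes "field_hom (\<iota> :: 'f::field \<Rightarrow> 'e::field)"
  shows "CHAR('e) = CHAR('f)"
proof -
  interpret field_hom \<iota> by fact
  have "of_nat n = (0 :: 'e) \<longleftrightarrow> of_nat n = (0 :: 'f)" for n
    by (metis hom_0_iff hom_of_nat)
  thus ?thesis
    by (metis CHAR_eqI of_nat_CHAR of_nat_eq_0_iff_char_dvd)
qed

text \<open>The fixed points are roots of \<open>X^q - X\<close>, which has at most \<open>q\<close>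
  of them, and the injective \<open>\<iota>\<close> already supplies \<open>q\<close>.\<close>

lemma mem_range_field_hom:
  fixes \<iota> :: "'f::{field, finite} \<Rightarrow> 'e::field"
  assumes "field_hom \<iota>" "prime CARD('f)" "x ^ CARD('f) = x"
  shows "x \<in> range \<iota>"
proof -
  interpret field_hom \<iota> by fact
  define q where "q = CARD('f)"
  define p :: "'e poly" where "p = Polynomial.monom 1 q - Polynomial.monom 1 1"
  have q: "q > 1"
    using assms(2) prime_gt_1_nat by (auto simp: q_def)
  have "Polynomial.coeff p q = 1"
    using q by (simp add: p_def)
  hence p0: "p \<noteq> 0"
    by auto
  have "degree p \<le> q"
    unfolding p_def by (rule degree_diff_le) (use q in \<open>simp_all add: degree_monom_eq\<close>)
  hence "card {y. poly p y = 0} \<le> q"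
    using card_poly_roots_bound[OF p0] by simp
  moreover have sub: "range \<iota> \<subseteq> {y. poly p y = 0}"
    using power_prime_CARD[OF assms(2)] by (auto simp: p_def poly_monom q_def simp flip: hom_power)
  moreover have "card (range \<iota>) = q"
    unfolding q_def by (rule card_image) (use eq_iff in \<open>auto intro!: injI\<close>)
  ultimately have "range \<iota> = {y. poly p y = 0}"
    using poly_roots_finite[OF p0] by (intro card_seteq) auto
  thus ?thesis
    using assms(3) by (auto simp: p_def poly_monom q_def)
qed

subsection \<open>Rank over a finite field\<close>

lemma mat_rank_eq_iff_det:
  assumes "A \<in> carrier_mat n n"
  shows "mat_rank A = n \<longleftrightarrow> Determinant.det A \<noteq> 0"
  using vec_space.det_rank_iff[OF assms] assms by (auto simp: mat_rank_def)

lemma bij_betw_carrier_vec: "bij_betw (vec n) ({..<n} \<rightarrow>\<^sub>E (UNIV :: 'a set)) (carrier_vec n :: 'a vec set)"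
proof (rule bij_betw_byWitness[where f' = "\<lambda>v. restrict (\<lambda>i. v $ i) {..<n}"])
  show "\<forall>f\<in>{..<n} \<rightarrow>\<^sub>E (UNIV :: 'a set). restrict (\<lambda>i. vec n f $ i) {..<n} = f"
  proof
    fix f :: "nat \<Rightarrow> 'a" assume f: "f \<in> {..<n} \<rightarrow>\<^sub>E (UNIV :: 'a set)"
    have "restrict (\<lambda>i. vec n f $ i) {..<n} = restrict f {..<n}"
      by (rule restrict_ext) simp
    thus "restrict (\<lambda>i. vec n f $ i) {..<n} = f"
      using PiE_restrict[OF f] by (simp only:)
  qed
  show "\<forall>v\<in>carrier_vec n :: 'a vec set. vec n (restrict (\<lambda>i. v $ i) {..<n}) = v"
    by (intro ballI eq_vecI) simp_all
  show "vec n ` ({..<n} \<rightarrow>\<^sub>E (UNIV :: 'a set)) \<subseteq> carrier_vec n"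
    by (intro image_subsetI vec_carrier)
  show "(\<lambda>v. restrict (\<lambda>i. v $ i) {..<n}) ` carrier_vec n \<subseteq> {..<n} \<rightarrow>\<^sub>E (UNIV :: 'a set)"
    by (simp add: image_subset_iff restrict_PiE_iff)
qed

lemma card_carrier_vec: "card (carrier_vec n :: 'a::finite vec set) = CARD('a) ^ n"
proof -
  have "card ({..<n} \<rightarrow>\<^sub>E (UNIV :: 'a set)) = CARD('a) ^ n"
    by (subst card_PiE) simp_all
  thus ?thesis
    by (simp only: bij_betw_same_card[OF bij_betw_carrier_vec])
qed

lemma finite_carrier_vec [simp]: "finite (carrier_vec n :: 'a::finite vec set)"
proof -
  have "finite ({..<n} \<rightarrow>\<^sub>E (UNIV :: 'a set))"
    by (rule finite_PiE) simp_all
  thus ?thesis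
    by (simp only: bij_betw_finite[OF bij_betw_carrier_vec])
qed

text \<open>The image of \<open>A\<close> is its column space, of dimension
  \<open>mat_rank A\<close>; coordinates in a basis match it with the functions from that basis to
  the field.\<close>

lemma card_range_mat:
  fixes A :: "'a::{field, finite} mat"
  assumes A: "A \<in> carrier_mat nr nc"
  shows "card ((*\<^sub>v) A ` carrier_vec nc) = CARD('a) ^ mat_rank A"
proof -
  interpret vec_space "TYPE('a)" nr .
  define W where "W = span_vs (set (cols A))"
  interpret W: vectorspace class_ring W
    unfolding W_def using A cols_dim[of A] by (intro subspace_is_vs span_is_subspace) auto
  have carr: "carrier W = (*\<^sub>v) A ` carrier_vec nc"
    using col_space_eq[OF A] A by (auto simp: W_def col_space_def)
  have "W.fin_dim"
    unfolding W_def by (rule fin_dim_span_cols[OF A])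
  then obtain b where b: "finite b" "W.basis b"
    using W.finite_basis_exists by blast
  have bW: "b \<subseteq> carrier W"
    using b by (simp add: W.basis_def)
  \<comment> \<open>Coefficient functions are extensional on \<open>b\<close>, so each vector has
    exactly one of them and coordinates form a bijection.\<close>
  have uniq: "\<exists>!a. a \<in> b \<rightarrow>\<^sub>E carrier class_ring \<and> W.lincomb a b = v" if "v \<in> carrier W" for v
    using W.basis_criterion[OF b(1) bW] b(2) that by simp
  have "bij_betw (\<lambda>a. W.lincomb a b) (b \<rightarrow>\<^sub>E UNIV) (carrier W)"
  proof (rule bij_betwI')
    fix v assume "v \<in> carrier W"
    thus "\<exists>a\<in>b \<rightarrow>\<^sub>E UNIV. v = W.lincomb a b"
      using uniq[of v] by auto
  next
    fix a a' assume *: "a \<in> b \<rightarrow>\<^sub>E (UNIV :: 'a set)" "a' \<in> b \<rightarrow>\<^sub>E (UNIV :: 'a set)"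
    have "W.lincomb a' b \<in> carrier W"
      using bW by (intro W.lincomb_closed) auto
    thus "(W.lincomb a b = W.lincomb a' b) = (a = a')"
      using uniq[of "W.lincomb a' b"] * by auto
  next
    fix a assume "a \<in> b \<rightarrow>\<^sub>E (UNIV :: 'a set)"
    thus "W.lincomb a b \<in> carrier W"
      using bW by (intro W.lincomb_closed) auto
  qed
  hence "card (carrier W) = card (b \<rightarrow>\<^sub>E (UNIV :: 'a set))"
    by (rule bij_betw_same_card[symmetric])
  also have "\<dots> = CARD('a) ^ card b"
    using b(1) by (simp add: card_PiE)
  also have "card b = mat_rank A"
    using W.dim_basis[OF b] A by (simp add: mat_rank_def rank_def W_def)
  finally show ?thesis
    by (simp add: carr)
qed

text \<open>Rank-nullity by counting: each nonempty fibre of \<open>A\<close> is a translate of the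
  kernel, so the whole space has at most \<open>CARD('a) ^ d\<close> vectors per image, and
  exponents can be compared.\<close>

lemma mat_rank_ge:
  fixes A :: "'a::{field, finite} mat"
  assumes A: "A \<in> carrier_mat nr nc"
    and ker: "card {v \<in> carrier_vec nc. A *\<^sub>v v = 0\<^sub>v nr} \<le> CARD('a) ^ d"
  shows "nc \<le> mat_rank A + d"
proof -
  define K where "K = {v \<in> carrier_vec nc. A *\<^sub>v v = 0\<^sub>v nr}"
  have fibre: "card {v \<in> carrier_vec nc. A *\<^sub>v v = y} \<le> card K" for y
  proof (cases "{v \<in> carrier_vec nc. A *\<^sub>v v = y} = {}")
    case False
    then obtain w where w: "w \<in> carrier_vec nc" "A *\<^sub>v w = y"
      by auto
    have Aw: "A *\<^sub>v w \<in> carrier_vec nr"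
      by (rule mult_mat_vec_carrier[OF A w(1)])
    show ?thesis
    proof (rule card_inj_on_le)
      show "inj_on (\<lambda>v. v - w) {v \<in> carrier_vec nc. A *\<^sub>v v = y}"
      proof (rule inj_onI)
        fix u v assume *: "u \<in> {v \<in> carrier_vec nc. A *\<^sub>v v = y}"
          "v \<in> {v \<in> carrier_vec nc. A *\<^sub>v v = y}" "u - w = v - w"
        have "u = (u - w) + w" "v = (v - w) + w"
          using *(1,2) w(1) by (auto simp: minus_add_uminus_vec[of _ nc])
        thus "u = v"
          using *(3) by simp
      qed
      show "(\<lambda>v. v - w) ` {v \<in> carrier_vec nc. A *\<^sub>v v = y} \<subseteq> K"
      proof
        fix x assume "x \<in> (\<lambda>v. v - w) ` {v \<in> carrier_vec nc. A *\<^sub>v v = y}"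
        then obtain v where v: "v \<in> carrier_vec nc" "A *\<^sub>v v = y" "x = v - w"
          by blast
        have "A *\<^sub>v x = y - y"
          unfolding v(3) mult_minus_distrib_mat_vec[OF A v(1) w(1)] v(2) w(2) ..
        thus "x \<in> K"
          using v(1,3) w Aw by (simp add: K_def)
      qed
    qed (simp add: K_def)
  next
    case True
    show ?thesis
      unfolding True by simp
  qed
  have "CARD('a) ^ nc = card (\<Union>y\<in>(*\<^sub>v) A ` carrier_vec nc. {v \<in> carrier_vec nc. A *\<^sub>v v = y})"
    unfolding card_carrier_vec[symmetric] by (rule arg_cong[where f = card]) auto
  also have "\<dots> \<le> (\<Sum>y\<in>(*\<^sub>v) A ` carrier_vec nc. card {v \<in> carrier_vec nc. A *\<^sub>v v = y})"
    by (rule card_UN_le) simp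
  also have "\<dots> \<le> (\<Sum>y\<in>(*\<^sub>v) A ` carrier_vec nc. CARD('a) ^ d)"
    using ker by (intro sum_mono order_trans[OF fibre]) (simp add: K_def)
  also have "\<dots> = CARD('a) ^ (mat_rank A + d)"
    by (simp add: card_range_mat[OF A] power_add)
  finally have le: "CARD('a) ^ nc \<le> CARD('a) ^ (mat_rank A + d)" .
  with one_less_CARD_field[where ?'a = 'a] show ?thesis
    by simp
qed

text \<open>The zero columns make the first \<open>d\<close> coordinates invisible, so every image
  already arises from a vector with \<open>d\<close> leading zeros.\<close>

lemma mat_rank_le:
  fixes A :: "'a::{field, finite} mat"
  assumes A: "A \<in> carrier_mat nr nc" and d: "d \<le> nc"
    and zero: "\<And>i j. i < nr \<Longrightarrow> j < d \<Longrightarrow> A $$ (i, j) = 0"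
  shows "mat_rank A \<le> nc - d"
proof -
  define g where "g w = A *\<^sub>v (vec nc (\<lambda>j. if j < d then 0 else w $ (j - d)))" for w
  have "(*\<^sub>v) A ` carrier_vec nc \<subseteq> g ` carrier_vec (nc - d)"
  proof
    fix y assume "y \<in> (*\<^sub>v) A ` carrier_vec nc"
    then obtain v where v: "v \<in> carrier_vec nc" "y = A *\<^sub>v v"
      by auto
    have "A *\<^sub>v v = g (vec (nc - d) (\<lambda>j. v $ (j + d)))"
      unfolding g_def using A v d zero
      by (intro eq_vecI) (auto simp: scalar_prod_def intro!: sum.cong)
    thus "y \<in> g ` carrier_vec (nc - d)"
      using v(2) by auto
  qed
  hence "card ((*\<^sub>v) A ` carrier_vec nc) \<le> card (g ` (carrier_vec (nc - d) :: 'a vec set))"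
    by (intro card_mono) auto
  also have "\<dots> \<le> CARD('a) ^ (nc - d)"
    using card_image_le[of "carrier_vec (nc - d) :: 'a vec set" g] by (simp add: card_carrier_vec)
  finally have le: "CARD('a) ^ mat_rank A \<le> CARD('a) ^ (nc - d)"
    by (simp add: card_range_mat[OF A])
  with one_less_CARD_field[where ?'a = 'a] show ?thesis
    by simp
qed

subsection \<open>Codes with simultaneously diagonalised blocks\<close>

lemma minus_vec_eq_zero_iff:
  fixes a b :: "'a::group_add vec"
  assumes "a \<in> carrier_vec n" "b \<in> carrier_vec n"
  shows "a - b = 0\<^sub>v n \<longleftrightarrow> a = b"
proof
  assume eq: "a - b = 0\<^sub>v n"
  have "a $ i = b $ i" if "i < n" for i
    using arg_cong[OF eq, of "\<lambda>v. v $ i"] that assms by simp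
  thus "a = b"
    using assms by (intro eq_vecI) auto
qed (use assms in simp)

lemma det_mat_diag: "Determinant.det (mat_diag n f) = (\<Prod>i<n. f i :: 'a::comm_ring_1)"
proof -
  have "Determinant.det (mat_diag n f) = prod_list (diag_mat (mat_diag n f))"
    by (rule det_upper_triangular[of _ n]) (auto simp: upper_triangular_def mat_diag_def)
  also have "diag_mat (mat_diag n f) = map f [0..<n]"
    by (auto simp: diag_mat_def mat_diag_def)
  finally show ?thesis
    by (simp add: prod.list_conv_set_nth lessThan_atLeast0)
qed

text \<open>This strips the invertible outer factors \<open>A\<close> and \<open>B\<close> later:
  the sums say that the transpose, which is invertible too, kills \<open>x\<close>.\<close>

lemma det_nonzero_row_combination:
  fixes A :: "'a::field mat"
  assumes A: "A \<in> carrier_mat n n" "Determinant.det A \<noteq> 0"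
    and zero: "\<And>j. j < n \<Longrightarrow> (\<Sum>i<n. A $$ (i, j) * x i) = 0" and i: "i < n"
  shows "x i = 0"
proof -
  have "transpose_mat A *\<^sub>v vec n x = 0\<^sub>v n"
    using A zero by (intro eq_vecI) (auto simp: scalar_prod_def lessThan_atLeast0)
  moreover have "Determinant.det (transpose_mat A) \<noteq> 0"
    using A by (simp add: det_transpose)
  moreover have "transpose_mat A \<in> carrier_mat n n" "vec n x \<in> carrier_vec n"
    using A by auto
  ultimately have "vec n x = 0\<^sub>v n"
    using det_0_iff_vec_prod_zero_field[of "transpose_mat A" n] by blast
  thus ?thesis
    using i by (metis index_vec index_zero_vec(1))
qed

lemma cyclic_perm_mat_carrier: "0 < L \<Longrightarrow> cyclic_perm_mat L \<in> carrier_mat L L"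
  by (auto simp: cyclic_perm_mat_def)

lemma root_of_unity_power_mod:
  assumes "(x :: 'a::monoid_mult) ^ L = 1"
  shows "x ^ (j mod L) = x ^ j"
proof -
  have "x ^ j = (x ^ L) ^ (j div L) * x ^ (j mod L)"
    by (simp flip: power_mult power_add)
  thus ?thesis
    by (simp add: assms)
qed

text \<open>The coding argument sees the blocks only through their common factorization, so the
  \<open>\<epsilon> t\<close> stay arbitrary here; that they are roots of unity enters only for
  consecutive shifts.\<close>

locale factored_blocks =
  fixes \<iota> :: "'f::{field, finite} \<Rightarrow> 'e::field" and q J L :: nat and P Q :: "'f mat"
    and A B :: "'e mat" and \<epsilon> :: "nat \<Rightarrow> 'e"
  assumes hom: "field_hom \<iota>" and q: "prime q" "CARD('f) = q" and L: "0 < L"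
    and P: "P \<in> carrier_mat J L" and Q: "Q \<in> carrier_mat L J"
    and A: "A \<in> carrier_mat J J" "Determinant.det A \<noteq> 0"
    and B: "B \<in> carrier_mat J J" "Determinant.det B \<noteq> 0"
    and factor: "\<And>l. map_mat \<iota> (P * cyclic_perm_mat L ^\<^sub>m l * Q) =
      A * mat_diag J (\<lambda>t. \<epsilon> t ^ l) * B"
begin

sublocale field_hom \<iota>
  by (rule hom)

section \<open>The full rank condition in the diagonal coordinates\<close>

lemma block_carrier: "P * cyclic_perm_mat L ^\<^sub>m l * Q \<in> carrier_mat J J"
  by (intro mult_carrier_mat[of _ J L] P Q pow_carrier_mat cyclic_perm_mat_carrier L)

lemma A_diag_B_entry:
  assumes "r < J" "c < J"
  shows "(A * mat_diag J x * B) $$ (r, c) = (\<Sum>t<J. A $$ (r, t) * x t * B $$ (t, c))"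
  using A B assms
  by (subst mat_diag_mult_right[OF A(1)]) (auto simp: scalar_prod_def lessThan_atLeast0)

lemma block_entry:
  assumes "r < J" "c < J"
  shows "\<iota> ((P * cyclic_perm_mat L ^\<^sub>m l * Q) $$ (r, c)) =
    (\<Sum>t<J. A $$ (r, t) * \<epsilon> t ^ l * B $$ (t, c))"
proof -
  have "\<iota> ((P * cyclic_perm_mat L ^\<^sub>m l * Q) $$ (r, c)) =
      map_mat \<iota> (P * cyclic_perm_mat L ^\<^sub>m l * Q) $$ (r, c)"
    using assms block_carrier[of l] by (subst index_map_mat) auto
  thus ?thesis
    by (simp add: factor A_diag_B_entry assms)
qed

text \<open>The combination inherits the factorization with diagonal entries \<open>x t\<close>, so
  its determinant over the extension is the product of the \<open>x t\<close> up to the nonzero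
  determinants of \<open>A\<close> and \<open>B\<close>.\<close>

lemma full_rank_combinations_iff:
  "full_rank_combinations n P Q l \<longleftrightarrow>
     (\<forall>a\<in>carrier_vec n. a \<noteq> 0\<^sub>v n \<longrightarrow> (\<forall>t<J. (\<Sum>i<n. \<iota> (a $ i) * \<epsilon> t ^ l i) \<noteq> 0))"
proof -
  have "mat_rank (mat_sum (dim_row P) (dim_col Q)
          (\<lambda>i. (a $ i) \<cdot>\<^sub>m (P * cyclic_perm_mat (dim_col P) ^\<^sub>m l i * Q)) {..<n}) = dim_row P \<longleftrightarrow>
        (\<forall>t<J. (\<Sum>i<n. \<iota> (a $ i) * \<epsilon> t ^ l i) \<noteq> 0)" (is "mat_rank ?N = _ \<longleftrightarrow> _") for a
  proof -
    define x where "x t = (\<Sum>i<n. \<iota> (a $ i) * \<epsilon> t ^ l i)" for t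
    have dims: "dim_row P = J" "dim_col P = L" "dim_col Q = J"
      using P Q by auto
    have N: "?N \<in> carrier_mat J J"
      by (simp add: mat_sum_def dims)
    have "\<iota> (?N $$ (r, c)) = (A * mat_diag J x * B) $$ (r, c)" if "r < J" "c < J" for r c
    proof -
      have "\<iota> (?N $$ (r, c)) =
          (\<Sum>i<n. \<iota> (a $ i) * \<iota> ((P * cyclic_perm_mat L ^\<^sub>m l i * Q) $$ (r, c)))"
        using that block_carrier[unfolded carrier_mat_def]
        by (simp add: mat_sum_def dims hom_sum hom_mult del: index_mult_mat(1))
      also have "\<dots> = (\<Sum>i<n. \<Sum>t<J. A $$ (r, t) * (\<iota> (a $ i) * \<epsilon> t ^ l i) * B $$ (t, c))"
        by (simp add: block_entry[OF that] sum_distrib_left mult_ac)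
      also have "\<dots> = (\<Sum>t<J. A $$ (r, t) * x t * B $$ (t, c))"
        by (subst sum.swap) (simp add: x_def sum_distrib_left sum_distrib_right)
      finally show ?thesis
        by (simp add: A_diag_B_entry[OF that])
    qed
    hence "map_mat \<iota> ?N = A * mat_diag J x * B"
      using N A B by (intro eq_matI) (auto simp del: index_mult_mat(1))
    hence "Determinant.det (map_mat \<iota> ?N) = Determinant.det (A * mat_diag J x) * Determinant.det B"
      using det_mult[OF mult_carrier_mat[OF A(1) mat_diag_dim] B(1)] by simp
    also have "Determinant.det (A * mat_diag J x) = Determinant.det A * (\<Prod>t<J. x t)"
      by (simp only: det_mult[OF A(1) mat_diag_dim] det_mat_diag)
    finally have "Determinant.det (map_mat \<iota> ?N) =
        Determinant.det A * (\<Prod>t<J. x t) * Determinant.det B" .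
    hence "Determinant.det ?N \<noteq> 0 \<longleftrightarrow> (\<forall>t<J. x t \<noteq> 0)"
      using A B hom_det[of ?N] hom_0_iff[of "Determinant.det ?N"] by auto
    thus ?thesis
      using mat_rank_eq_iff_det[OF N] by (simp only: dims x_def)
  qed
  thus ?thesis
    by (simp add: full_rank_combinations_def)
qed

section \<open>Codeword entries as values of linearized polynomials\<close>

lemma cs_encode_carrier: "cs_encode r k n P Q l m \<in> carrier_mat J n"
  using Q by (auto simp: cs_encode_def mat_of_cols_def)

lemma cs_encode_entry:
  assumes m: "\<And>s. s < k \<Longrightarrow> m s \<in> carrier_vec J" and c: "c < J" and i: "i < n"
  shows "cs_encode q k n P Q l m $$ (c, i) =
    (\<Sum>s<k. \<Sum>r<J. (P * cyclic_perm_mat L ^\<^sub>m (q ^ s * l i) * Q) $$ (r, c) * m s $ r)"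
proof -
  define M where "M s = P * cyclic_perm_mat L ^\<^sub>m (q ^ s * l i) * Q" for s
  have M: "M s \<in> carrier_mat J J" for s
    unfolding M_def by (rule block_carrier)
  have "cs_encode q k n P Q l m $$ (c, i) =
      finsum_vec TYPE('f) J (\<lambda>s. transpose_mat (M s) *\<^sub>v m s) {..<k} $ c"
    using P Q c i by (simp add: cs_encode_def mat_of_cols_def M_def)
  also have "\<dots> = (\<Sum>s<k. (transpose_mat (M s) *\<^sub>v m s) $ c)"
    using M m by (subst index_finsum_vec[OF _ c]) (auto intro!: mult_mat_vec_carrier)
  also have "\<dots> = (\<Sum>s<k. \<Sum>r<J. M s $$ (r, c) * m s $ r)"
  proof (rule sum.cong[OF refl])
    fix s assume "s \<in> {..<k}"
    thus "(transpose_mat (M s) *\<^sub>v m s) $ c = (\<Sum>r<J. M s $$ (r, c) * m s $ r)"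
      using M[of s] m[of s] c by (auto simp: scalar_prod_def lessThan_atLeast0)
  qed
  finally show ?thesis
    by (simp add: M_def)
qed

lemma cs_encode_cong:
  assumes m: "\<And>s. s < k \<Longrightarrow> m s \<in> carrier_vec J" and eq: "\<And>s. s < k \<Longrightarrow> m s = m' s"
  shows "cs_encode q k n P Q l m = cs_encode q k n P Q l m'"
proof (rule eq_matI)
  have m': "m' s \<in> carrier_vec J" if "s < k" for s
    using m eq that by metis
  fix c i
  assume "c < dim_row (cs_encode q k n P Q l m')" "i < dim_col (cs_encode q k n P Q l m')"
  hence "c < J" "i < n"
    using cs_encode_carrier[of q k n l m'] by auto
  thus "cs_encode q k n P Q l m $$ (c, i) = cs_encode q k n P Q l m' $$ (c, i)"
    using m m' by (simp add: cs_encode_entry eq del: index_mult_mat(1))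
qed (use cs_encode_carrier[of q k n l m] cs_encode_carrier[of q k n l m'] in auto)

text \<open>This is the coefficient at \<open>X ^ (q ^ s)\<close> of the linearized polynomial
  belonging to the diagonal position \<open>t\<close>.\<close>

definition coefficient :: "(nat \<Rightarrow> 'f vec) \<Rightarrow> nat \<Rightarrow> nat \<Rightarrow> 'e" where
  "coefficient m s t = (\<Sum>r<J. A $$ (r, t) * \<iota> (m s $ r))"

text \<open>Since \<open>\<epsilon> t ^ (q ^ s * l i)\<close> is the \<open>q ^ s\<close>-th power
  of \<open>\<epsilon> t ^ l i\<close>, the inner sum is the \<open>t\<close>-th linearized
  polynomial evaluated at \<open>\<epsilon> t ^ l i\<close>; the entries of \<open>B\<close> only
  mix these values.\<close>

lemma cs_encode_entry_ext:
  assumes m: "\<And>s. s < k \<Longrightarrow> m s \<in> carrier_vec J" and c: "c < J" and i: "i < n"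
  shows "\<iota> (cs_encode q k n P Q l m $$ (c, i)) =
    (\<Sum>t<J. B $$ (t, c) * (\<Sum>s<k. coefficient m s t * (\<epsilon> t ^ l i) ^ (q ^ s)))"
proof -
  have "\<iota> (cs_encode q k n P Q l m $$ (c, i)) =
      (\<Sum>s<k. \<Sum>r<J. \<Sum>t<J. A $$ (r, t) * \<epsilon> t ^ (q ^ s * l i) * B $$ (t, c) * \<iota> (m s $ r))"
    by (simp add: cs_encode_entry[OF m c i] hom_sum hom_mult block_entry c sum_distrib_right
          del: index_mult_mat(1))
  also have "\<dots> = (\<Sum>s<k. \<Sum>t<J. \<Sum>r<J.
      A $$ (r, t) * \<epsilon> t ^ (q ^ s * l i) * B $$ (t, c) * \<iota> (m s $ r))"
    by (intro sum.cong refl sum.swap)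
  also have "\<dots> = (\<Sum>t<J. \<Sum>s<k. \<Sum>r<J.
      A $$ (r, t) * \<epsilon> t ^ (q ^ s * l i) * B $$ (t, c) * \<iota> (m s $ r))"
    by (rule sum.swap)
  also have "\<dots> = (\<Sum>t<J. B $$ (t, c) * (\<Sum>s<k. coefficient m s t * (\<epsilon> t ^ l i) ^ (q ^ s)))"
    by (simp add: coefficient_def sum_distrib_left sum_distrib_right mult_ac flip: power_mult)
  finally show ?thesis .
qed

text \<open>The \<open>q\<close>-th power map is additive in characteristic \<open>q\<close> and
  fixes the image of the small field; hence linearized polynomials are linear over that
  field.\<close>

lemma frobenius_sum:
  "(\<Sum>i\<in>I. \<iota> (a i) * x i) ^ (q ^ s) = (\<Sum>i\<in>I. \<iota> (a i) * x i ^ (q ^ s))"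
proof -
  have prime: "prime CARD('f)"
    using q by simp
  have char: "CHAR('e) = q"
    using CHAR_field_hom[OF hom] CHAR_eq_prime_CARD[OF prime] q(2) by simp
  have "b ^ (q ^ s) = b" for b :: 'f
    by (induction s) (use power_prime_CARD[OF prime] q(2) in \<open>simp_all add: power_mult mult.commute[of q]\<close>)
  hence fixed: "\<iota> b ^ (q ^ s) = \<iota> b" for b
    by (metis hom_power)
  have "(\<Sum>i\<in>I. \<iota> (a i) * x i) ^ (q ^ s) = (\<Sum>i\<in>I. (\<iota> (a i) * x i) ^ (q ^ s))"
    by (rule freshmans_dream_sum'[where n = s]) (simp_all add: char q(1))
  thus ?thesis
    by (simp only: power_mult_distrib fixed)
qed

text \<open>By linearity over the small field, a relation \<open>a\<close> between the columns of a
  codeword turns into a root of every linearized polynomial; invertibility of \<open>B\<close>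
  separates the positions \<open>t\<close>.\<close>

lemma cs_encode_kernel:
  assumes m: "\<And>s. s < k \<Longrightarrow> m s \<in> carrier_vec J" and a: "a \<in> carrier_vec n"
    and zero: "cs_encode q k n P Q l m *\<^sub>v a = 0\<^sub>v J" and t: "t < J"
  shows "(\<Sum>s<k. coefficient m s t * (\<Sum>i<n. \<iota> (a $ i) * \<epsilon> t ^ l i) ^ (q ^ s)) = 0"
proof (rule det_nonzero_row_combination[OF B _ t])
  fix c assume c: "c < J"
  have "0 = \<iota> ((cs_encode q k n P Q l m *\<^sub>v a) $ c)"
    using c by (simp add: zero)
  also have "\<dots> = (\<Sum>i<n. \<iota> (cs_encode q k n P Q l m $$ (c, i)) * \<iota> (a $ i))"
    using cs_encode_carrier[of q k n l m] a c
    by (auto simp: scalar_prod_def hom_sum hom_mult lessThan_atLeast0)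
  also have "\<dots> = (\<Sum>i<n. \<Sum>t<J. \<Sum>s<k.
      B $$ (t, c) * (coefficient m s t * (\<epsilon> t ^ l i) ^ (q ^ s)) * \<iota> (a $ i))"
    by (simp add: cs_encode_entry_ext[OF m c] sum_distrib_left sum_distrib_right)
  also have "\<dots> = (\<Sum>t<J. \<Sum>i<n. \<Sum>s<k.
      B $$ (t, c) * (coefficient m s t * (\<epsilon> t ^ l i) ^ (q ^ s)) * \<iota> (a $ i))"
    by (rule sum.swap)
  also have "\<dots> = (\<Sum>t<J. \<Sum>s<k. \<Sum>i<n.
      B $$ (t, c) * (coefficient m s t * (\<epsilon> t ^ l i) ^ (q ^ s)) * \<iota> (a $ i))"
    by (intro sum.cong refl sum.swap)
  also have "\<dots> = (\<Sum>t<J. B $$ (t, c) *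
      (\<Sum>s<k. coefficient m s t * (\<Sum>i<n. \<iota> (a $ i) * \<epsilon> t ^ l i) ^ (q ^ s)))"
    unfolding frobenius_sum by (simp add: sum_distrib_left sum_distrib_right mult_ac)
  finally show "(\<Sum>t<J. B $$ (t, c) *
      (\<Sum>s<k. coefficient m s t * (\<Sum>i<n. \<iota> (a $ i) * \<epsilon> t ^ l i) ^ (q ^ s))) = 0"
    by simp
qed

text \<open>For fixed \<open>s\<close> the coefficients form the transpose of \<open>A\<close>
  applied to \<open>m s\<close>, and \<open>A\<close> is invertible.\<close>

lemma coefficient_nonzero:
  assumes m: "\<And>s. s < k \<Longrightarrow> m s \<in> carrier_vec J" and nz: "s < k" "m s \<noteq> 0\<^sub>v J"
  obtains t where "t < J" "coefficient m s t \<noteq> 0"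
proof -
  have False if "\<And>t. t < J \<Longrightarrow> coefficient m s t = 0"
  proof -
    have "\<iota> (m s $ r) = 0" if "r < J" for r
      by (rule det_nonzero_row_combination[OF A _ that])
         (use \<open>\<And>t. t < J \<Longrightarrow> coefficient m s t = 0\<close> in \<open>simp add: coefficient_def\<close>)
    hence "m s = 0\<^sub>v J"
      using m[OF nz(1)] by (intro eq_vecI) auto
    thus False
      using nz(2) by simp
  qed
  thus ?thesis
    using that by blast
qed

text \<open>The full rank condition makes \<open>x\<close> injective, so the kernel of the codeword
  embeds into the root set of the nonzero polynomial \<open>p\<close>, and the kernel bound becomes
  a rank bound.\<close>

lemma mat_rank_cs_encode:
  assumes full: "full_rank_combinations n P Q l"
    and m: "\<And>s. s < k \<Longrightarrow> m s \<in> carrier_vec J" and nz: "s < k" "m s \<noteq> 0\<^sub>v J"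
  shows "n \<le> mat_rank (cs_encode q k n P Q l m) + (k - 1)"
proof -
  obtain t where t: "t < J" "coefficient m s t \<noteq> 0"
    using coefficient_nonzero[of k m s, OF m nz] by blast
  define x where "x a = (\<Sum>i<n. \<iota> (a $ i) * \<epsilon> t ^ l i)" for a
  have q1: "q > 1"
    using q(1) by (rule prime_gt_1_nat)
  define p where "p = (\<Sum>s<k. Polynomial.monom (coefficient m s t) (q ^ s))"
  \<comment> \<open>As \<open>q > 1\<close>, the exponents \<open>q ^ s\<close> are distinct, so no
    two monomials merge.\<close>
  have "Polynomial.coeff p (q ^ s) = (\<Sum>s'<k. if s' = s then coefficient m s' t else 0)"
    using q1 by (simp add: p_def coeff_sum)
  hence "Polynomial.coeff p (q ^ s) \<noteq> 0"
    using nz(1) t(2) by simp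
  hence p0: "p \<noteq> 0"
    by auto
  have "degree p \<le> q ^ (k - 1)"
    unfolding p_def
  proof (rule degree_sum_le)
    fix s assume "s \<in> {..<k}"
    hence "q ^ s \<le> q ^ (k - 1)"
      using q1 by (intro power_increasing) auto
    thus "degree (Polynomial.monom (coefficient m s t) (q ^ s)) \<le> q ^ (k - 1)"
      using degree_monom_le order_trans by blast
  qed simp
  have "card {a \<in> carrier_vec n. cs_encode q k n P Q l m *\<^sub>v a = 0\<^sub>v J} \<le> card {y. poly p y = 0}"
  proof (rule card_inj_on_le)
    show "inj_on x {a \<in> carrier_vec n. cs_encode q k n P Q l m *\<^sub>v a = 0\<^sub>v J}"
    proof (rule inj_onI, rule ccontr)
      fix a b assume *: "a \<in> {a \<in> carrier_vec n. cs_encode q k n P Q l m *\<^sub>v a = 0\<^sub>v J}"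
        "b \<in> {a \<in> carrier_vec n. cs_encode q k n P Q l m *\<^sub>v a = 0\<^sub>v J}" "x a = x b" "a \<noteq> b"
      have ab: "a \<in> carrier_vec n" "b \<in> carrier_vec n" "a - b \<in> carrier_vec n"
        using *(1,2) by auto
      have "a - b \<noteq> 0\<^sub>v n"
        using *(4) minus_vec_eq_zero_iff[OF ab(1,2)] by simp
      hence "x (a - b) \<noteq> 0"
        using full ab(3) t(1) unfolding full_rank_combinations_iff x_def by blast
      moreover have "(a - b) $ i = a $ i - b $ i" if "i < n" for i
        using ab(1,2) that by simp
      hence "x (a - b) = x a - x b"
        by (simp add: x_def hom_minus left_diff_distrib sum_subtractf)
      ultimately show False
        using *(3) by simp
    qed
    show "x ` {a \<in> carrier_vec n. cs_encode q k n P Q l m *\<^sub>v a = 0\<^sub>v J} \<subseteq> {y. poly p y = 0}"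
    proof (clarsimp simp: p_def poly_sum poly_monom)
      fix a :: "'f vec" assume "a \<in> carrier_vec n" "cs_encode q k n P Q l m *\<^sub>v a = 0\<^sub>v J"
      thus "(\<Sum>s<k. coefficient m s t * x a ^ q ^ s) = 0"
        unfolding x_def using cs_encode_kernel[where k = k and n = n and l = l, OF m _ _ t(1)] by simp
    qed
  qed (rule poly_roots_finite[OF p0])
  also have "\<dots> \<le> q ^ (k - 1)"
    using card_poly_roots_bound[OF p0] \<open>degree p \<le> q ^ (k - 1)\<close> by linarith
  finally show ?thesis
    using mat_rank_ge[OF cs_encode_carrier] q(2) by simp
qed

text \<open>Encoding is linear, which reduces distances between codewords to ranks of single
  codewords.\<close>

lemma cs_encode_diff:
  assumes m: "\<And>s. s < k \<Longrightarrow> m s \<in> carrier_vec J" "\<And>s. s < k \<Longrightarrow> m' s \<in> carrier_vec J"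
  shows "cs_encode q k n P Q l (\<lambda>s. m s - m' s) = cs_encode q k n P Q l m - cs_encode q k n P Q l m'"
proof (rule eq_matI)
  fix c i
  assume "c < dim_row (cs_encode q k n P Q l m - cs_encode q k n P Q l m')"
    "i < dim_col (cs_encode q k n P Q l m - cs_encode q k n P Q l m')"
  hence ci: "c < J" "i < n"
    using cs_encode_carrier[of q k n l m'] by auto
  have md: "m s - m' s \<in> carrier_vec J" if "s < k" for s
    using m[OF that] by simp
  have "(m s - m' s) $ r = m s $ r - m' s $ r" if "s < k" "r < J" for s r
    using m[OF that(1)] that(2) by simp
  thus "cs_encode q k n P Q l (\<lambda>s. m s - m' s) $$ (c, i) =
      (cs_encode q k n P Q l m - cs_encode q k n P Q l m') $$ (c, i)"
    using cs_encode_carrier[of q k n l m] cs_encode_carrier[of q k n l m'] ci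
    by (simp add: cs_encode_entry m md right_diff_distrib sum_subtractf del: index_mult_mat(1))
qed (use cs_encode_carrier[of q k n l m'] cs_encode_carrier[of q k n l "\<lambda>s. m s - m' s"] in auto)

lemma rank_dist_cs_encode:
  assumes full: "full_rank_combinations n P Q l"
    and m: "\<And>s. s < k \<Longrightarrow> m s \<in> carrier_vec J" "\<And>s. s < k \<Longrightarrow> m' s \<in> carrier_vec J"
    and ne: "s < k" "m s \<noteq> m' s"
  shows "n \<le> rank_dist (cs_encode q k n P Q l m) (cs_encode q k n P Q l m') + (k - 1)"
proof -
  have "m s - m' s \<noteq> 0\<^sub>v J"
    using ne(2) minus_vec_eq_zero_iff[OF m(1,2)[OF ne(1)]] by simp
  hence "n \<le> mat_rank (cs_encode q k n P Q l (\<lambda>s. m s - m' s)) + (k - 1)"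
    using m by (intro mat_rank_cs_encode[OF full _ ne(1)]) auto
  thus ?thesis
    by (simp add: rank_dist_def cs_encode_diff[of k m m', OF m])
qed

section \<open>Size and minimum distance of the code\<close>

lemma cs_code_subset: "cs_code q k n P Q l \<subseteq> carrier_mat J n"
  using cs_encode_carrier by (auto simp: cs_code_def)

text \<open>Distinct messages give codewords at positive distance because \<open>k - 1 < n\<close>,
  so counting codewords amounts to counting messages.\<close>

lemma card_cs_code:
  assumes full: "full_rank_combinations n P Q l" and kn: "1 \<le> k" "k \<le> n"
  shows "card (cs_code q k n P Q l) = q ^ (J * k)"
proof -
  \<comment> \<open>Only components below \<open>k\<close> affect a codeword; extensional functions
    give each message exactly one representative.\<close>
  define X where "X = {..<k} \<rightarrow>\<^sub>E (carrier_vec J :: 'f vec set)"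
  have "cs_code q k n P Q l = cs_encode q k n P Q l ` X"
  proof
    show "cs_code q k n P Q l \<subseteq> cs_encode q k n P Q l ` X"
    proof
      fix C assume "C \<in> cs_code q k n P Q l"
      then obtain m where m: "C = cs_encode q k n P Q l m" "\<And>s. s < k \<Longrightarrow> m s \<in> carrier_vec J"
        using P by (auto simp: cs_code_def)
      let ?m = "restrict m {..<k}"
      have "C = cs_encode q k n P Q l ?m"
        unfolding m(1) by (rule cs_encode_cong) (simp_all add: m(2))
      moreover have "?m \<in> X"
        using m(2) by (auto simp: X_def)
      ultimately show "C \<in> cs_encode q k n P Q l ` X"
        by blast
    qed
    show "cs_encode q k n P Q l ` X \<subseteq> cs_code q k n P Q l"
      using P by (auto simp: cs_code_def X_def)
  qed
  moreover have "inj_on (cs_encode q k n P Q l) X"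
  proof (rule inj_onI, rule ccontr)
    fix m m' assume *: "m \<in> X" "m' \<in> X" "cs_encode q k n P Q l m = cs_encode q k n P Q l m'" "m \<noteq> m'"
    then obtain s where s: "s < k" "m s \<noteq> m' s"
      unfolding X_def by (metis PiE_ext lessThan_iff)
    have "cs_encode q k n P Q l m - cs_encode q k n P Q l m' = 0\<^sub>m J n"
      unfolding *(3) using cs_encode_carrier[of q k n l m'] by (intro eq_matI) auto
    hence "rank_dist (cs_encode q k n P Q l m) (cs_encode q k n P Q l m') = 0"
      by (simp add: rank_dist_def mat_rank_def vec_space.rank_0I)
    thus False
      using rank_dist_cs_encode[OF full, of k m m' s] * s kn by (fastforce simp: X_def)
  qed
  ultimately have "card (cs_code q k n P Q l) = card X"
    by (simp add: card_image)
  also have "\<dots> = q ^ (J * k)"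
    by (simp add: X_def card_PiE card_carrier_vec q(2) power_mult)
  finally show ?thesis .
qed

text \<open>The upper bound on the distance is the pigeonhole argument of the Singleton bound, applied to
  the first \<open>k - 1\<close> columns.\<close>

lemma has_min_rank_dist_cs_code:
  assumes full: "full_rank_combinations n P Q l" and kn: "1 \<le> k" "k \<le> n" and J: "0 < J"
  shows "has_min_rank_dist (cs_code q k n P Q l) (n - k + 1)"
proof -
  let ?C = "cs_code q k n P Q l"
  have ge: "n - k + 1 \<le> rank_dist X Y" if "X \<in> ?C" "Y \<in> ?C" "X \<noteq> Y" for X Y
  proof -
    obtain m m' where m: "X = cs_encode q k n P Q l m" "\<And>s. s < k \<Longrightarrow> m s \<in> carrier_vec J"
      and m': "Y = cs_encode q k n P Q l m'" "\<And>s. s < k \<Longrightarrow> m' s \<in> carrier_vec J"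
      using \<open>X \<in> ?C\<close> \<open>Y \<in> ?C\<close> P by (auto simp: cs_code_def)
    have "\<exists>s<k. m s \<noteq> m' s"
    proof (rule ccontr)
      assume "\<not> ?thesis"
      hence eq: "m s = m' s" if "s < k" for s
        using that by blast
      have "X = Y"
        unfolding m(1) m'(1) using m(2) eq by (rule cs_encode_cong)
      with \<open>X \<noteq> Y\<close> show False ..
    qed
    then obtain s where "s < k" "m s \<noteq> m' s"
      by blast
    hence "n \<le> rank_dist X Y + (k - 1)"
      unfolding m(1) m'(1) using m(2) m'(2) by (intro rank_dist_cs_encode[OF full]) auto
    thus ?thesis
      using kn by linarith
  qed
  define h :: "'f mat \<Rightarrow> _" where "h X = restrict (\<lambda>ij. X $$ ij) ({..<J} \<times> {..<k - 1})" for X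
  have q1: "q > 1"
    using q(1) by (rule prime_gt_1_nat)
  have "h ` ?C \<subseteq> ({..<J} \<times> {..<k - 1}) \<rightarrow>\<^sub>E UNIV"
    by (simp add: h_def image_subset_iff restrict_PiE_iff)
  hence "card (h ` ?C) \<le> card (({..<J} \<times> {..<k - 1}) \<rightarrow>\<^sub>E (UNIV :: 'f set))"
    by (intro card_mono finite_PiE) auto
  also have "\<dots> = q ^ (J * (k - 1))"
    by (simp add: card_PiE q(2))
  \<comment> \<open>Positive \<open>J\<close> makes this strict, so two codewords must share their
    first \<open>k - 1\<close> columns.\<close>
  also have "\<dots> < q ^ (J * k)"
    using q1 J kn by (intro power_strict_increasing) auto
  also have "\<dots> = card ?C"
    by (simp add: card_cs_code[OF full kn])
  finally have "\<not> inj_on h ?C"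
    by (rule pigeonhole)
  then obtain X Y where XY: "X \<in> ?C" "Y \<in> ?C" "X \<noteq> Y" "h X = h Y"
    by (auto simp: inj_on_def)
  have carr: "X \<in> carrier_mat J n" "Y \<in> carrier_mat J n"
    using XY cs_code_subset by blast+
  have "(X - Y) $$ (i, j) = 0" if "i < J" "j < k - 1" for i j
    using that carr kn fun_cong[OF XY(4), of "(i, j)"] by (simp add: h_def)
  \<comment> \<open>The \<open>k - 1\<close> zero columns cap the rank at exactly the lower bound
    \<open>ge\<close>.\<close>
  hence "mat_rank (X - Y) \<le> n - (k - 1)"
    using carr kn by (intro mat_rank_le[of _ J]) auto
  hence "rank_dist X Y = n - k + 1"
    using ge[OF XY(1-3)] kn by (simp add: rank_dist_def)
  thus ?thesis
    unfolding has_min_rank_dist_def using XY(1-3) ge by blast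
qed

text \<open>A polynomial of degree less than \<open>n\<close> over the small field that vanishes at \<open>\<epsilon> t\<close> also vanishes at
  the conjugates \<open>\<epsilon> t ^ q ^ s\<close>.\<close>

lemma full_rank_combinations_consecutive:
  assumes conj: "\<And>t. t < J \<Longrightarrow> inj_on (\<lambda>s. \<epsilon> t ^ q ^ s) {..<n}"
    and root: "\<And>t. t < J \<Longrightarrow> \<epsilon> t ^ L = 1"
  shows "full_rank_combinations n P Q (\<lambda>i. (i + c) mod L)"
  unfolding full_rank_combinations_iff
proof (intro ballI impI allI notI)
  fix a :: "'f vec" and t
  assume a: "a \<in> carrier_vec n" "a \<noteq> 0\<^sub>v n" and t: "t < J"
    and zero: "(\<Sum>i<n. \<iota> (a $ i) * \<epsilon> t ^ ((i + c) mod L)) = 0"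
  obtain i where i: "i < n" "a $ i \<noteq> 0"
    using a by (metis carrier_vecD eq_vecI index_zero_vec)
  define p where "p = (\<Sum>i<n. Polynomial.monom (\<iota> (a $ i)) i)"
  have "Polynomial.coeff p i = \<iota> (a $ i)"
    using i(1) by (simp add: p_def coeff_sum)
  hence p0: "p \<noteq> 0"
    using i(2) by auto
  have "degree p \<le> n - 1"
    unfolding p_def
  proof (rule degree_sum_le)
    fix i assume "i \<in> {..<n}"
    thus "degree (Polynomial.monom (\<iota> (a $ i)) i) \<le> n - 1"
      using degree_monom_le[of "\<iota> (a $ i)" i] by auto
  qed simp
  have e0: "\<epsilon> t \<noteq> 0"
    using root[OF t] L by (auto simp: power_0_left)
  \<comment> \<open>Exponents may be reduced modulo \<open>L\<close>, so the offset \<open>c\<close>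
    contributes only the nonzero factor \<open>\<epsilon> t ^ c\<close>.\<close>
  have "0 = \<epsilon> t ^ c * (\<Sum>i<n. \<iota> (a $ i) * \<epsilon> t ^ i)"
    using zero by (simp add: root_of_unity_power_mod[OF root[OF t]] power_add sum_distrib_left mult_ac)
  hence sum0: "(\<Sum>i<n. \<iota> (a $ i) * \<epsilon> t ^ i) = 0"
    using e0 by simp
  have "poly p (\<epsilon> t ^ q ^ s) = 0" for s
  proof -
    have "poly p (\<epsilon> t ^ q ^ s) = (\<Sum>i<n. \<iota> (a $ i) * \<epsilon> t ^ i) ^ q ^ s"
      unfolding frobenius_sum by (simp add: p_def poly_sum poly_monom mult.commute flip: power_mult)
    thus ?thesis
      using sum0 q(1) by (simp add: prime_gt_0_nat)
  qed
  \<comment> \<open>By \<open>conj\<close> these are \<open>n\<close> distinct roots, more than the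
    degree bound \<open>n - 1\<close> permits.\<close>
  hence "(\<lambda>s. \<epsilon> t ^ q ^ s) ` {..<n} \<subseteq> {y. poly p y = 0}"
    by auto
  hence "card ((\<lambda>s. \<epsilon> t ^ q ^ s) ` {..<n}) \<le> card {y. poly p y = 0}"
    by (intro card_mono poly_roots_finite p0)
  hence "n \<le> degree p"
    using card_poly_roots_bound[OF p0] by (simp add: card_image[OF conj[OF t]])
  thus False
    using \<open>degree p \<le> n - 1\<close> i(1) by linarith
qed

end

subsection \<open>Diagonalising the cyclic permutation matrix\<close>

lemma primitive_root_nonzero:
  assumes "is_primitive_root_of_unity L \<beta>" "0 < L"
  shows "\<beta> \<noteq> 0"
  using assms by (auto simp: is_primitive_root_of_unity_def power_0_left)

lemma primitive_root_power_mod: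
  "is_primitive_root_of_unity L \<beta> \<Longrightarrow> \<beta> ^ (j mod L) = \<beta> ^ j"
  by (simp add: is_primitive_root_of_unity_def root_of_unity_power_mod)

lemma primitive_root_power_eq_1_iff:
  assumes "is_primitive_root_of_unity L \<beta>" "0 < L"
  shows "\<beta> ^ j = 1 \<longleftrightarrow> L dvd j"
proof -
  have "\<beta> ^ (j mod L) = 1 \<longleftrightarrow> j mod L = 0"
    using assms by (cases "j mod L = 0") (auto simp: is_primitive_root_of_unity_def)
  thus ?thesis
    by (simp add: primitive_root_power_mod[OF assms(1)] dvd_eq_mod_eq_0)
qed

lemma primitive_root_power_eq_iff:
  assumes "is_primitive_root_of_unity L \<beta>" "0 < L"
  shows "\<beta> ^ i = \<beta> ^ j \<longleftrightarrow> i mod L = j mod L"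
proof -
  have aux: "i mod L = j mod L" if "\<beta> ^ i = \<beta> ^ j" "i \<le> j" for i j
  proof -
    have "\<beta> ^ j = \<beta> ^ i * \<beta> ^ (j - i)"
      using that(2) by (simp flip: power_add)
    hence "\<beta> ^ (j - i) = 1"
      using that(1) primitive_root_nonzero[OF assms] by simp
    hence "L dvd j - i"
      by (simp add: primitive_root_power_eq_1_iff[OF assms])
    thus ?thesis
      using mod_eq_dvd_iff_nat[OF that(2), of L] by simp
  qed
  show ?thesis
  proof
    assume "\<beta> ^ i = \<beta> ^ j"
    thus "i mod L = j mod L"
      using aux[of i j] aux[of j i, symmetric] le_cases[of i j] by metis
  next
    assume "i mod L = j mod L"
    hence "\<beta> ^ (i mod L) = \<beta> ^ (j mod L)"
      by (rule arg_cong)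
    thus "\<beta> ^ i = \<beta> ^ j"
      by (simp only: primitive_root_power_mod[OF assms(1)])
  qed
qed

section \<open>The cyclic shift in the Fourier basis\<close>

lemma cyclic_perm_mat_index:
  assumes "i < L" "j < L"
  shows "cyclic_perm_mat L $$ (i, j) = (if j = Suc i mod L then 1 else 0)"
  using assms by (auto simp: cyclic_perm_mat_def mod_Suc)

lemma dim_mat_diag [simp]: "dim_row (mat_diag n f) = n" "dim_col (mat_diag n f) = n"
  by (simp_all add: mat_diag_def)

lemma dim_vandermonde_neg [simp]:
  "dim_row (vandermonde_neg L \<beta>) = L" "dim_col (vandermonde_neg L \<beta>) = L"
  by (simp_all add: vandermonde_neg_def)

lemma dim_cyclic_perm_mat:
  assumes "0 < L"
  shows "dim_row (cyclic_perm_mat L) = L" "dim_col (cyclic_perm_mat L) = L"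
  using assms by (simp_all add: cyclic_perm_mat_def)

lemma index_mult_mat_sum:
  assumes "A \<in> carrier_mat nr n" "B \<in> carrier_mat n nc" "i < nr" "j < nc"
  shows "(A * B) $$ (i, j) = (\<Sum>k<n. A $$ (i, k) * B $$ (k, j))"
  using assms by (simp add: scalar_prod_def lessThan_atLeast0)

lemma vandermonde_neg_carrier: "vandermonde_neg L \<beta> \<in> carrier_mat L L"
  by (simp add: vandermonde_neg_def)

text \<open>Row \<open>j\<close> lists the powers of the inverse of \<open>\<beta> ^ j\<close>,
  hence is a left eigenvector of the shift with eigenvalue \<open>\<beta> ^ j\<close>; the
  wrap-around is absorbed by \<open>\<beta> ^ L = 1\<close>.\<close>

lemma vandermonde_neg_mult_cyclic:
  fixes \<beta> :: "'a::field"
  assumes \<beta>: "is_primitive_root_of_unity L \<beta>" and L: "0 < L"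
  shows "vandermonde_neg L \<beta> * cyclic_perm_mat L = mat_diag L (\<lambda>j. \<beta> ^ j) * vandermonde_neg L \<beta>"
proof (rule eq_matI)
  fix j c assume "j < dim_row (mat_diag L (\<lambda>j. \<beta> ^ j) * vandermonde_neg L \<beta>)"
    "c < dim_col (mat_diag L (\<lambda>j. \<beta> ^ j) * vandermonde_neg L \<beta>)"
  hence jc: "j < L" "c < L"
    by simp_all
  \<comment> \<open>\<open>i\<close> is the cyclic predecessor of \<open>c\<close>, the only row
    with a nonzero entry in column \<open>c\<close> of the shift.\<close>
  define i where "i = (if c = 0 then L - 1 else c - 1)"
  have i: "i < L" "c = Suc i mod L"
    using jc L by (cases "c = 0"; simp add: i_def)+
  have uniq: "c = Suc i' mod L \<longleftrightarrow> i' = i" if "i' < L" for i'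
    using that jc(2) by (cases "Suc i' = L") (auto simp: i_def)
  have "(vandermonde_neg L \<beta> * cyclic_perm_mat L) $$ (j, c) =
      (\<Sum>i'<L. vandermonde_neg L \<beta> $$ (j, i') * cyclic_perm_mat L $$ (i', c))"
    by (rule index_mult_mat_sum[OF vandermonde_neg_carrier cyclic_perm_mat_carrier[OF L] jc])
  also have "\<dots> = (\<Sum>i'<L. if i' = i then vandermonde_neg L \<beta> $$ (j, i') else 0)"
    by (rule sum.cong) (simp_all add: cyclic_perm_mat_index jc(2) uniq)
  also have "\<dots> = inverse (\<beta> ^ (j * i))"
    using i(1) jc(1) by (simp add: vandermonde_neg_def)
  also have "\<beta> ^ (j * c) = \<beta> ^ j * \<beta> ^ (j * i)"
  proof -
    have "\<beta> ^ (j * c) = \<beta> ^ (j * c mod L)"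
      by (simp add: primitive_root_power_mod[OF \<beta>])
    also have "j * c mod L = (j * Suc i) mod L"
      unfolding i(2) by (simp add: mod_mult_right_eq)
    also have "\<beta> ^ (j * Suc i mod L) = \<beta> ^ (j * Suc i)"
      by (rule primitive_root_power_mod[OF \<beta>])
    finally show ?thesis
      by (simp add: power_add)
  qed
  hence "inverse (\<beta> ^ (j * i)) = \<beta> ^ j * inverse (\<beta> ^ (j * c))"
    using primitive_root_nonzero[OF \<beta> L] by (simp add: field_simps)
  finally show "(vandermonde_neg L \<beta> * cyclic_perm_mat L) $$ (j, c) =
      (mat_diag L (\<lambda>j. \<beta> ^ j) * vandermonde_neg L \<beta>) $$ (j, c)"
    unfolding mat_diag_mult_left[OF vandermonde_neg_carrier] using jc by (simp add: vandermonde_neg_def)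
qed (simp_all add: dim_cyclic_perm_mat[OF L])

lemma vandermonde_neg_mult_cyclic_pow:
  fixes \<beta> :: "'a::field"
  assumes \<beta>: "is_primitive_root_of_unity L \<beta>" and L: "0 < L"
  shows "vandermonde_neg L \<beta> * cyclic_perm_mat L ^\<^sub>m l =
    mat_diag L (\<lambda>j. (\<beta> ^ j) ^ l) * vandermonde_neg L \<beta>"
proof (induction l)
  case 0
  show ?case
    using vandermonde_neg_carrier[of L \<beta>] cyclic_perm_mat_carrier[OF L, where ?'a = 'a] by simp
next
  case (Suc l)
  let ?V = "vandermonde_neg L \<beta>" and ?C = "cyclic_perm_mat L :: 'a mat"
  let ?D = "\<lambda>l. mat_diag L (\<lambda>j. (\<beta> ^ j) ^ l)"
  note carr = vandermonde_neg_carrier[of L \<beta>] cyclic_perm_mat_carrier[OF L, where ?'a = 'a]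
    pow_carrier_mat[OF cyclic_perm_mat_carrier[OF L, where ?'a = 'a], of l]
  have "?V * ?C ^\<^sub>m Suc l = ?V * ?C ^\<^sub>m l * ?C"
    using assoc_mult_mat[OF carr(1,3,2)] by simp
  also have "\<dots> = ?D l * (?V * ?C)"
    unfolding Suc.IH by (rule assoc_mult_mat[OF mat_diag_dim carr(1,2)])
  also have "\<dots> = ?D l * mat_diag L (\<lambda>j. \<beta> ^ j) * ?V"
    unfolding vandermonde_neg_mult_cyclic[OF \<beta> L]
    by (rule assoc_mult_mat[OF mat_diag_dim mat_diag_dim carr(1), symmetric])
  also have "?D l * mat_diag L (\<lambda>j. \<beta> ^ j) = ?D (Suc l)"
    by (simp add: mult.commute)
  finally show ?case .
qed

lemma poly_mat_carrier: "A \<in> carrier_mat n n \<Longrightarrow> poly_mat p A \<in> carrier_mat n n"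
  by (simp add: poly_mat_def mat_sum_def)

text \<open>Left eigenvectors of the shift are left eigenvectors of every polynomial in it: the
  power case is summed against the coefficients of \<open>p\<close>.\<close>

lemma vandermonde_neg_mult_poly_cyclic:
  fixes \<beta> :: "'a::field"
  assumes \<beta>: "is_primitive_root_of_unity L \<beta>" and L: "0 < L"
  shows "vandermonde_neg L \<beta> * poly_mat p (cyclic_perm_mat L) =
    mat_diag L (\<lambda>j. poly p (\<beta> ^ j)) * vandermonde_neg L \<beta>"
proof (rule eq_matI)
  let ?V = "vandermonde_neg L \<beta>" and ?C = "cyclic_perm_mat L :: 'a mat"
  note V = vandermonde_neg_carrier[of L \<beta>] and C = cyclic_perm_mat_carrier[OF L, where ?'a = 'a]
  have dims: "dim_row ?C = L" "dim_col ?C = L"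
    using C by auto
  fix j c assume "j < dim_row (mat_diag L (\<lambda>j. poly p (\<beta> ^ j)) * ?V)"
    "c < dim_col (mat_diag L (\<lambda>j. poly p (\<beta> ^ j)) * ?V)"
  hence jc: "j < L" "c < L"
    by simp_all
  have "(?V * poly_mat p ?C) $$ (j, c) = (\<Sum>i<L. ?V $$ (j, i) * poly_mat p ?C $$ (i, c))"
    by (rule index_mult_mat_sum[OF V poly_mat_carrier[OF C] jc])
  also have "\<dots> = (\<Sum>i<L. ?V $$ (j, i) * (\<Sum>d\<le>degree p. Polynomial.coeff p d * (?C ^\<^sub>m d) $$ (i, c)))"
    using jc by (simp add: poly_mat_def mat_sum_def dims)
  also have "\<dots> = (\<Sum>i<L. \<Sum>d\<le>degree p. Polynomial.coeff p d * (?V $$ (j, i) * (?C ^\<^sub>m d) $$ (i, c)))"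
    by (simp add: sum_distrib_left mult_ac)
  also have "\<dots> = (\<Sum>d\<le>degree p. \<Sum>i<L. Polynomial.coeff p d * (?V $$ (j, i) * (?C ^\<^sub>m d) $$ (i, c)))"
    by (rule sum.swap)
  also have "\<dots> = (\<Sum>d\<le>degree p. Polynomial.coeff p d * (?V * ?C ^\<^sub>m d) $$ (j, c))"
  proof (rule sum.cong[OF refl])
    fix d
    show "(\<Sum>i<L. Polynomial.coeff p d * (?V $$ (j, i) * (?C ^\<^sub>m d) $$ (i, c))) =
        Polynomial.coeff p d * (?V * ?C ^\<^sub>m d) $$ (j, c)"
      by (simp add: index_mult_mat_sum[OF V pow_carrier_mat[OF C] jc] sum_distrib_left)
  qed
  also have "\<dots> = (\<Sum>d\<le>degree p. Polynomial.coeff p d * (\<beta> ^ j) ^ d) * ?V $$ (j, c)"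
    using jc by (simp add: vandermonde_neg_mult_cyclic_pow[OF \<beta> L] mat_diag_mult_left[OF V]
        sum_distrib_right mult.assoc)
  finally show "(?V * poly_mat p ?C) $$ (j, c) = (mat_diag L (\<lambda>j. poly p (\<beta> ^ j)) * ?V) $$ (j, c)"
    using jc by (simp add: mat_diag_mult_left[OF V] poly_altdef)
qed (simp_all add: poly_mat_def mat_sum_def dim_cyclic_perm_mat[OF L])

text \<open>Each entry is a geometric sum in the \<open>L\<close>-th root of unity
  \<open>inverse (\<beta> ^ (i + j))\<close>, which is 1 exactly when
  \<open>L dvd i + j\<close>.\<close>

lemma vandermonde_neg_mult_transpose:
  fixes \<beta> :: "'a::field"
  assumes \<beta>: "is_primitive_root_of_unity L \<beta>" and L: "0 < L" and ij: "i < L" "j < L"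
  shows "(vandermonde_neg L \<beta> * transpose_mat (vandermonde_neg L \<beta>)) $$ (i, j) =
    (if L dvd i + j then of_nat L else 0)"
proof -
  define x where "x = inverse (\<beta> ^ (i + j))"
  have "inverse (\<beta> ^ (i * r)) * inverse (\<beta> ^ (j * r)) = x ^ r" for r
    by (simp add: x_def power_inverse power_add power_mult power_mult_distrib)
  moreover have "(vandermonde_neg L \<beta> * transpose_mat (vandermonde_neg L \<beta>)) $$ (i, j) =
      (\<Sum>r<L. inverse (\<beta> ^ (i * r)) * inverse (\<beta> ^ (j * r)))"
    using ij by (simp add: vandermonde_neg_def scalar_prod_def lessThan_atLeast0)
  ultimately have "(vandermonde_neg L \<beta> * transpose_mat (vandermonde_neg L \<beta>)) $$ (i, j) = (\<Sum>r<L. x ^ r)"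
    by (simp only:)
  moreover have "x ^ L = 1"
  proof -
    have "(\<beta> ^ (i + j)) ^ L = (\<beta> ^ L) ^ (i + j)"
      by (simp add: mult.commute flip: power_mult)
    thus ?thesis
      using \<beta> by (simp add: x_def power_inverse is_primitive_root_of_unity_def)
  qed
  moreover have "x = 1 \<longleftrightarrow> L dvd i + j"
    by (simp add: x_def inverse_eq_1_iff primitive_root_power_eq_1_iff[OF \<beta> L])
  ultimately show ?thesis
    using geometric_sum[of x L] by auto
qed

section \<open>Extending scalars from the small field\<close>

lemma map_mat_cyclic_perm_mat:
  assumes "field_hom \<iota>" "0 < L"
  shows "map_mat \<iota> (cyclic_perm_mat L) = cyclic_perm_mat L"
proof -
  interpret field_hom \<iota> by fact
  show ?thesis
    by (rule eq_matI) (simp_all add: cyclic_perm_mat_index dim_cyclic_perm_mat[OF assms(2)])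
qed

lemma map_mat_poly_mat:
  assumes "field_hom \<iota>" and A: "A \<in> carrier_mat n n"
  shows "map_mat \<iota> (poly_mat p A) = poly_mat (map_poly \<iota> p) (map_mat \<iota> A)"
proof -
  interpret field_hom \<iota> by fact
  have pow: "map_mat \<iota> (A ^\<^sub>m d) = map_mat \<iota> A ^\<^sub>m d" for d
    by (rule mat_hom_pow[OF A])
  have entry: "(map_mat \<iota> A ^\<^sub>m d) $$ (i, j) = \<iota> ((A ^\<^sub>m d) $$ (i, j))" if "i < n" "j < n" for d i j
    unfolding pow[symmetric] using that A pow_carrier_mat[OF A, of d] by (intro index_map_mat) auto
  interpret mp: map_poly_inj_idom_hom \<iota> ..
  have dims: "dim_row (map_mat \<iota> A) = n" "dim_col (map_mat \<iota> A) = n" "dim_row A = n" "dim_col A = n"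
    using A by auto
  show ?thesis
  proof (rule eq_matI)
    fix i j assume "i < dim_row (poly_mat (map_poly \<iota> p) (map_mat \<iota> A))"
      "j < dim_col (poly_mat (map_poly \<iota> p) (map_mat \<iota> A))"
    hence ij: "i < n" "j < n"
      by (simp_all add: poly_mat_def mat_sum_def dims)
    have "map_mat \<iota> (poly_mat p A) $$ (i, j) =
        (\<Sum>d\<le>degree p. \<iota> (Polynomial.coeff p d * (A ^\<^sub>m d) $$ (i, j)))"
      using ij by (simp add: poly_mat_def mat_sum_def dims hom_sum)
    also have "\<dots> = poly_mat (map_poly \<iota> p) (map_mat \<iota> A) $$ (i, j)"
      using ij by (simp add: poly_mat_def mat_sum_def dims hom_mult entry)
    finally show "map_mat \<iota> (poly_mat p A) $$ (i, j) = poly_mat (map_poly \<iota> p) (map_mat \<iota> A) $$ (i, j)" .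
  qed (simp_all add: poly_mat_def mat_sum_def dims)
qed

subsection \<open>The polynomial tau\<close>

lemma finite_unit_indices [simp]: "finite (unit_indices L)"
  by (rule finite_subset[of _ "{..L}"]) (auto simp: unit_indices_def)

lemma unit_indices_less: "j \<in> unit_indices L \<Longrightarrow> j < L"
  by (auto simp: unit_indices_def)

text \<open>Units modulo \<open>L\<close> are closed under negation; this keeps the reflected
  columns of \<open>U\<close> among the unit columns.\<close>

lemma diff_mem_unit_indices:
  assumes "j \<in> unit_indices L"
  shows "L - j \<in> unit_indices L"
proof -
  have "1 \<le> j" "j < L" "coprime j L"
    using assms by (auto simp: unit_indices_def)
  moreover have "coprime (L - j) L"
  proof (rule coprimeI)
    fix c assume c: "c dvd L - j" "c dvd L"
    hence "c dvd j"
      using \<open>j < L\<close> by (blast intro: dvd_diffD1 less_imp_le)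
    thus "is_unit c"
      using \<open>coprime j L\<close> c(2) by (blast intro: coprime_common_divisor)
  qed
  ultimately show ?thesis
    by (auto simp: unit_indices_def)
qed

lemma poly_tau_ext_eq_0_iff:
  assumes \<beta>: "is_primitive_root_of_unity L \<beta>" and L: "0 < L" and j: "j < L"
  shows "poly (tau_ext L \<beta>) (\<beta> ^ j) = 0 \<longleftrightarrow> j \<notin> unit_indices L"
proof -
  have "poly (tau_ext L \<beta>) (\<beta> ^ j) = 0 \<longleftrightarrow> (\<exists>i\<in>{..<L} - unit_indices L. \<beta> ^ j = \<beta> ^ i)"
    by (simp add: tau_ext_def poly_prod)
  also have "\<dots> \<longleftrightarrow> (\<exists>i\<in>{..<L} - unit_indices L. j = i)"
    using j by (intro bex_cong) (auto simp: primitive_root_power_eq_iff[OF \<beta> L])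
  finally show ?thesis
    using j by auto
qed

text \<open>Frobenius sends the root \<open>\<beta> ^ j\<close> to \<open>\<beta> ^ (j * q)\<close>,
  and multiplication by \<open>q\<close> permutes the non-units modulo \<open>L\<close>, so the
  linear factors are only reordered.\<close>

lemma map_poly_power_prime_tau_ext:
  fixes \<beta> :: "'e::field"
  assumes \<beta>: "is_primitive_root_of_unity L \<beta>" and L: "0 < L" "coprime q L"
    and q: "prime q" "CHAR('e) = q"
  shows "map_poly (\<lambda>x. x ^ q) (tau_ext L \<beta>) = tau_ext L \<beta>"
proof -
  define S where "S = {..<L} - unit_indices L"
  have q0: "q > 0"
    using q(1) by (rule prime_gt_0_nat)
  interpret F: comm_ring_hom "\<lambda>x :: 'e. x ^ q"
    by unfold_locales (use q q0 in \<open>simp_all add: freshmans_dream power_mult_distrib\<close>)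
  interpret MF: map_poly_comm_ring_hom "\<lambda>x :: 'e. x ^ q" ..
  have minus: "(- x) ^ q = - (x ^ q)" for x :: 'e
    by (rule F.hom_uminus)
  have bij: "bij_betw (\<lambda>j. j * q mod L) S S"
  proof -
    have inj: "inj_on (\<lambda>j. j * q mod L) S"
    proof (rule inj_onI)
      fix i j assume ij: "i \<in> S" "j \<in> S" "i * q mod L = j * q mod L"
      hence "[i * q = j * q] (mod L)"
        by (simp add: cong_def)
      hence "[i = j] (mod L)"
        using cong_mult_rcancel_nat[OF L(2)] by blast
      thus "i = j"
        using ij(1,2) by (simp add: S_def cong_def)
    qed
    have sub: "(\<lambda>j. j * q mod L) ` S \<subseteq> S"
    proof clarify
      fix j assume j: "j \<in> S"
      have "j \<in> unit_indices L" if "j * q mod L \<in> unit_indices L"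
      proof -
        have *: "1 \<le> j * q mod L" "coprime (j * q mod L) L"
          using that by (simp_all add: unit_indices_def)
        have "coprime (j * q) L"
          using *(2) L(1) coprime_mod_left_iff[of L "j * q"] by blast
        hence "coprime j L"
          by simp
        \<comment> \<open>Coprimality alone would not rule out \<open>j = 0\<close> for
          \<open>L = 1\<close>, so this index is excluded separately.\<close>
        moreover have "j \<noteq> 0"
          using *(1) by (rule contrapos_pn) simp
        ultimately show ?thesis
          using j by (auto simp: S_def unit_indices_def)
      qed
      thus "j * q mod L \<in> S"
        using j L(1) by (auto simp: S_def)
    qed
    show ?thesis
      unfolding bij_betw_def using inj endo_inj_surj[OF _ sub inj] by (simp add: S_def)
  qed
  have "map_poly (\<lambda>x. x ^ q) (tau_ext L \<beta>) = (\<Prod>j\<in>S. map_poly (\<lambda>x. x ^ q) [:- (\<beta> ^ j), 1:])"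
    unfolding tau_ext_def S_def by (rule MF.hom_prod)
  also have "\<dots> = (\<Prod>j\<in>S. [:- (\<beta> ^ (j * q mod L)), 1:])"
    using q0 by (simp add: map_poly_pCons minus primitive_root_power_mod[OF \<beta>] power_mult)
  also have "\<dots> = tau_ext L \<beta>"
    unfolding tau_ext_def S_def[symmetric] by (rule prod.reindex_bij_betw[OF bij])
  finally show ?thesis .
qed

text \<open>The coefficients are fixed by the \<open>q\<close>-th power map and so lie in the range
  of \<open>\<iota>\<close>, where \<open>inv_into\<close> is a genuine inverse.\<close>

lemma map_poly_tau:
  fixes \<iota> :: "'f::{field, finite} \<Rightarrow> 'e::field"
  assumes hom: "field_hom \<iota>" and q: "prime q" "CARD('f) = q"
    and \<beta>: "is_primitive_root_of_unity L \<beta>" and L: "0 < L" "coprime q L"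
  shows "map_poly \<iota> (tau \<iota> L \<beta>) = tau_ext L \<beta>"
proof (rule poly_eqI)
  interpret field_hom \<iota> by (rule hom)
  have prime: "prime CARD('f)"
    using q by simp
  have char: "CHAR('e) = q"
    using CHAR_field_hom[OF hom] CHAR_eq_prime_CARD[OF prime] q(2) by simp
  \<comment> \<open>Reading \<open>map_poly\<close> coefficient by coefficient requires a map that
    sends 0 to 0.\<close>
  have inv0: "inv_into UNIV \<iota> 0 = 0"
    using inv_f_f[of 0] by simp
  fix i
  have "Polynomial.coeff (map_poly (\<lambda>x. x ^ q) (tau_ext L \<beta>)) i = Polynomial.coeff (tau_ext L \<beta>) i ^ q"
    using q(1) by (subst coeff_map_poly) (auto simp: prime_gt_0_nat)
  hence "Polynomial.coeff (tau_ext L \<beta>) i ^ CARD('f) = Polynomial.coeff (tau_ext L \<beta>) i"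
    unfolding q(2) map_poly_power_prime_tau_ext[OF \<beta> L q(1) char] by (rule sym)
  hence "Polynomial.coeff (tau_ext L \<beta>) i \<in> range \<iota>"
    by (rule mem_range_field_hom[OF hom prime])
  thus "Polynomial.coeff (map_poly \<iota> (tau \<iota> L \<beta>)) i = Polynomial.coeff (tau_ext L \<beta>) i"
    by (simp add: tau_def coeff_map_poly inv0 f_inv_into_f)
qed

subsection \<open>The circular-shift-based code\<close>

text \<open>This translates column numbers of a submatrix into elements of the index set;
  \<open>pick\<close> is strictly increasing below \<open>card I\<close>, and cardinalities
  agree.\<close>

lemma bij_betw_pick:
  assumes "finite I"
  shows "bij_betw (pick I) {..<card I} I"
  unfolding bij_betw_def
proof
  show inj: "inj_on (pick I) {..<card I}"
  proof (rule linorder_inj_onI)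
    fix i j assume "i < j" "i \<in> {..<card I}" "j \<in> {..<card I}"
    thus "pick I i \<noteq> pick I j"
      using pick_mono_le[of j I i] by simp
  qed auto
  have "pick I ` {..<card I} \<subseteq> I"
    using pick_in_set_le by auto
  thus "pick I ` {..<card I} = I"
    using assms by (intro card_subset_eq) (simp_all add: card_image[OF inj])
qed

text \<open>The column \<open>L - j\<close> appears because the product of the Vandermonde matrix with its own transpose is
  \<open>L\<close> times the permutation matrix of \<open>j \<mapsto> - j\<close>.\<close>

lemma block_index:
  fixes \<beta> :: "'e::field"
  assumes hom: "field_hom \<iota>" and L: "0 < L" and \<beta>: "is_primitive_root_of_unity L \<beta>"
    and U: "U \<in> carrier_mat J L" and G: "map_mat \<iota> G = U * vandermonde_neg L \<beta>"
    and tau: "map_poly \<iota> p = tau_ext L \<beta>" and rc: "r < J" "c < J"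
  shows "map_mat \<iota> (G * cyclic_perm_mat L ^\<^sub>m l * (poly_mat p (cyclic_perm_mat L) * transpose_mat G)) $$ (r, c) =
    (\<Sum>j\<in>unit_indices L. U $$ (r, j) * (\<beta> ^ j) ^ l *
       (of_nat L * poly (tau_ext L \<beta>) (\<beta> ^ j) * U $$ (c, L - j)))"
proof -
  interpret field_hom \<iota> by (rule hom)
  let ?V = "vandermonde_neg L \<beta>" and ?C = "cyclic_perm_mat L :: 'e mat" and ?T = "tau_ext L \<beta>"
  define T where "T = poly_mat ?T ?C"
  \<comment> \<open>This diagonal matrix is what remains after \<open>?V\<close> has been moved to
    the right past the shift power and past \<open>T\<close>.\<close>
  define D where "D = mat_diag L (\<lambda>j. (\<beta> ^ j) ^ l * poly ?T (\<beta> ^ j))"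
  note V = vandermonde_neg_carrier[of L \<beta>]
  note C = cyclic_perm_mat_carrier[OF L, where ?'a = 'e]
  note C' = cyclic_perm_mat_carrier[OF L, where ?'a = 'a]
  note Cl = pow_carrier_mat[OF C, of l]
  have T: "T \<in> carrier_mat L L"
    unfolding T_def using C by (rule poly_mat_carrier)
  have VT: "transpose_mat ?V \<in> carrier_mat L L" and UT: "transpose_mat U \<in> carrier_mat L J"
    using V U by auto
  have Y: "transpose_mat ?V * transpose_mat U \<in> carrier_mat L J"
    by (rule mult_carrier_mat[OF VT UT])
  have X: "mat_diag L (\<lambda>j. (\<beta> ^ j) ^ l) * ?V \<in> carrier_mat L L"
    by (rule mult_carrier_mat[OF mat_diag_dim V])
  have D: "D \<in> carrier_mat L L"
    by (simp add: D_def)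
  have "map_mat \<iota> G \<in> carrier_mat J L"
    unfolding G using U V by simp
  hence Gc: "G \<in> carrier_mat J L"
    by simp
  have GT: "transpose_mat G \<in> carrier_mat L J"
    using Gc by simp
  have pC: "poly_mat p (cyclic_perm_mat L) \<in> carrier_mat L L"
    using C' by (rule poly_mat_carrier)
  have "map_mat \<iota> (G * cyclic_perm_mat L ^\<^sub>m l * (poly_mat p (cyclic_perm_mat L) * transpose_mat G)) =
      map_mat \<iota> G * map_mat \<iota> (cyclic_perm_mat L ^\<^sub>m l) *
      (map_mat \<iota> (poly_mat p (cyclic_perm_mat L)) * map_mat \<iota> (transpose_mat G))"
    by (simp only: mat_hom_mult[OF mult_carrier_mat[OF Gc pow_carrier_mat[OF C']] mult_carrier_mat[OF pC GT]]
        mat_hom_mult[OF Gc pow_carrier_mat[OF C']] mat_hom_mult[OF pC GT])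
  also have "map_mat \<iota> (cyclic_perm_mat L ^\<^sub>m l) = ?C ^\<^sub>m l"
    by (simp only: mat_hom_pow[OF C'] map_mat_cyclic_perm_mat[OF hom L])
  also have "map_mat \<iota> (poly_mat p (cyclic_perm_mat L)) = T"
    by (simp only: map_mat_poly_mat[OF hom C'] tau map_mat_cyclic_perm_mat[OF hom L] T_def)
  also have "map_mat \<iota> (transpose_mat G) = transpose_mat ?V * transpose_mat U"
    by (simp only: transpose_mult[OF U V, symmetric] G[symmetric]) auto
  also have "map_mat \<iota> G * ?C ^\<^sub>m l * (T * (transpose_mat ?V * transpose_mat U)) =
      U * (?V * ?C ^\<^sub>m l) * (T * (transpose_mat ?V * transpose_mat U))"
    by (simp only: G assoc_mult_mat[OF U V Cl])
  also have "?V * ?C ^\<^sub>m l = mat_diag L (\<lambda>j. (\<beta> ^ j) ^ l) * ?V"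
    by (rule vandermonde_neg_mult_cyclic_pow[OF \<beta> L])
  also have "U * (mat_diag L (\<lambda>j. (\<beta> ^ j) ^ l) * ?V) * (T * (transpose_mat ?V * transpose_mat U)) =
      U * (mat_diag L (\<lambda>j. (\<beta> ^ j) ^ l) * (?V * T) * (transpose_mat ?V * transpose_mat U))"
    by (simp only: assoc_mult_mat[OF U X mult_carrier_mat[OF T Y]]
        assoc_mult_mat[OF X T Y, symmetric] assoc_mult_mat[OF mat_diag_dim V T])
  also have "mat_diag L (\<lambda>j. (\<beta> ^ j) ^ l) * (?V * T) = D * ?V"
    unfolding T_def vandermonde_neg_mult_poly_cyclic[OF \<beta> L] D_def
    by (subst assoc_mult_mat[OF mat_diag_dim mat_diag_dim V, symmetric]) simp
  also have "U * (D * ?V * (transpose_mat ?V * transpose_mat U)) =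
      U * (D * ((?V * transpose_mat ?V) * transpose_mat U))"
    by (simp only: assoc_mult_mat[OF D V Y] assoc_mult_mat[OF V VT UT])
  finally have eq: "map_mat \<iota> (G * cyclic_perm_mat L ^\<^sub>m l * (poly_mat p (cyclic_perm_mat L) * transpose_mat G)) =
      U * (D * ((?V * transpose_mat ?V) * transpose_mat U))" .
  define W where "W = (?V * transpose_mat ?V) * transpose_mat U"
  have W: "W \<in> carrier_mat L J"
    using V U by (simp add: W_def)
  \<comment> \<open>Unit rows suffice, as \<open>D\<close> vanishes at the other diagonal positions;
    for them \<open>L - j\<close> is a valid column index.\<close>
  have W_index: "W $$ (j, c) = of_nat L * U $$ (c, L - j)" if j: "j \<in> unit_indices L" for j
  proof -
    have jL: "j < L" "1 \<le> j"
      using j by (auto simp: unit_indices_def)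
    have "W $$ (j, c) = (\<Sum>i<L. (?V * transpose_mat ?V) $$ (j, i) * transpose_mat U $$ (i, c))"
      unfolding W_def by (rule index_mult_mat_sum[OF mult_carrier_mat[OF V VT] UT jL(1) rc(2)])
    also have "\<dots> = (\<Sum>i<L. if i = L - j then of_nat L * U $$ (c, i) else 0)"
    proof (rule sum.cong[OF refl])
      fix i assume "i \<in> {..<L}"
      hence i: "i < L"
        by simp
      \<comment> \<open>As \<open>0 < j + i < 2 * L\<close>, the only possible multiple is
        \<open>L\<close> itself.\<close>
      have "L dvd j + i \<longleftrightarrow> i = L - j"
      proof
        assume "L dvd j + i"
        then obtain d where d: "j + i = L * d"
          by (elim dvdE)
        have "d = 1"
        proof (rule ccontr)
          assume "d \<noteq> 1"
          then consider "d = 0" | "2 \<le> d"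
            by linarith
          thus False
          proof cases
            case 2
            hence "L * 2 \<le> L * d"
              by (rule mult_le_mono2)
            thus ?thesis
              using d i jL by linarith
          qed (use d jL in simp)
        qed
        thus "i = L - j"
          using d by simp
      qed (use jL in simp)
      thus "(?V * transpose_mat ?V) $$ (j, i) * transpose_mat U $$ (i, c) =
          (if i = L - j then of_nat L * U $$ (c, i) else 0)"
        using U i rc by (simp add: vandermonde_neg_mult_transpose[OF \<beta> L jL(1) i])
    qed
    also have "\<dots> = of_nat L * U $$ (c, L - j)"
      using jL by simp
    finally show ?thesis .
  qed
  have "(U * (D * W)) $$ (r, c) =
      (\<Sum>j<L. U $$ (r, j) * ((\<beta> ^ j) ^ l * poly ?T (\<beta> ^ j) * W $$ (j, c)))"
    unfolding index_mult_mat_sum[OF U mult_carrier_mat[OF D W] rc]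
    unfolding D_def mat_diag_mult_left[OF W] using rc by (intro sum.cong) simp_all
  \<comment> \<open>The dropped terms carry the factor \<open>poly ?T (\<beta> ^ j)\<close>, which
    is zero for non-units.\<close>
  also have "\<dots> = (\<Sum>j\<in>unit_indices L. U $$ (r, j) * ((\<beta> ^ j) ^ l * poly ?T (\<beta> ^ j) * W $$ (j, c)))"
    by (rule sum.mono_neutral_right)
       (auto simp: poly_tau_ext_eq_0_iff[OF \<beta> L] dest: unit_indices_less)
  also have "\<dots> = (\<Sum>j\<in>unit_indices L. U $$ (r, j) * (\<beta> ^ j) ^ l *
       (of_nat L * poly ?T (\<beta> ^ j) * U $$ (c, L - j)))"
    by (rule sum.cong) (simp_all add: W_index mult_ac)
  finally show ?thesis
    unfolding eq W_def .
qed

section \<open>Assembling the factorization of the blocks\<close>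

lemma submatrix_columns:
  assumes U: "U \<in> carrier_mat J L" and I: "I \<subseteq> {..<L}"
  shows "submatrix U UNIV I \<in> carrier_mat J (card I)"
    and "i < J \<Longrightarrow> t < card I \<Longrightarrow> submatrix U UNIV I $$ (i, t) = U $$ (i, pick I t)"
proof -
  have eq: "{j. j < dim_col U \<and> j \<in> I} = I" "{i. i < dim_row U \<and> i \<in> UNIV} = {..<J}"
    using U I by auto
  show "submatrix U UNIV I \<in> carrier_mat J (card I)"
    by (intro carrier_matI) (simp_all only: dim_submatrix eq card_lessThan)
  show "submatrix U UNIV I $$ (i, t) = U $$ (i, pick I t)" if "i < J" "t < card I"
    using submatrix_index[of i U UNIV t I] that by (simp only: eq card_lessThan pick_UNIV)
qed

text \<open>\<open>A\<close> collects the unit columns of \<open>U\<close>. \<open>B\<close> is the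
  transpose of \<open>A\<close> with its rows permuted by \<open>j \<mapsto> L - j\<close> and
  scaled by nonzero factors, hence invertible as well.\<close>

lemma factored_blocks_cyclic:
  fixes \<iota> :: "'f::{field, finite} \<Rightarrow> 'e::field"
  assumes hom: "field_hom \<iota>" and q: "prime q" "CARD('f) = q"
    and L: "0 < L" "coprime q L" and \<beta>: "is_primitive_root_of_unity L \<beta>"
    and J: "J = card (unit_indices L)" and U: "U \<in> carrier_mat J L"
    and rank_U: "mat_rank (submatrix U UNIV (unit_indices L)) = J"
    and G: "map_mat \<iota> G = U * vandermonde_neg L \<beta>"
  obtains A B where "factored_blocks \<iota> q J L G
    (poly_mat (tau \<iota> L \<beta>) (cyclic_perm_mat L) * transpose_mat G) A B (\<lambda>t. \<beta> ^ pick (unit_indices L) t)"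
proof -
  define I where "I = unit_indices L"
  define T where "T = tau_ext L \<beta>"
  define A where "A = submatrix U UNIV I"
  define B where "B = mat J J (\<lambda>(t, c). of_nat L * poly T (\<beta> ^ pick I t) * U $$ (c, L - pick I t))"
  have IL: "I \<subseteq> {..<L}"
    by (auto simp: I_def unit_indices_less)
  have bij: "bij_betw (pick I) {..<J} I"
    unfolding J I_def by (rule bij_betw_pick) simp
  have pickI: "pick I t \<in> I" if "t < J" for t
    using bij that by (auto simp: bij_betw_def)
  have A: "A \<in> carrier_mat J J"
    using submatrix_columns(1)[OF U IL] by (simp add: A_def J I_def)
  have A_index: "A $$ (i, t) = U $$ (i, pick I t)" if "i < J" "t < J" for i t
    unfolding A_def using that by (intro submatrix_columns(2)[OF U IL]) (simp_all add: J I_def)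
  have detA: "Determinant.det A \<noteq> 0"
    using rank_U mat_rank_eq_iff_det[OF A] by (simp add: A_def I_def)
  have B: "B \<in> carrier_mat J J"
    by (simp add: B_def)
  have char: "CHAR('e) = q"
    using CHAR_field_hom[OF hom] CHAR_eq_prime_CARD[where ?'a = 'f] q by simp
  have "\<not> q dvd L"
    using L(2) q(1) coprime_absorb_left[of q L] not_prime_unit[of q] by blast
  hence L0: "of_nat L \<noteq> (0 :: 'e)"
    by (simp add: of_nat_eq_0_iff_char_dvd char)
  have T0: "poly T (\<beta> ^ j) \<noteq> 0" if "j \<in> I" for j
    using that poly_tau_ext_eq_0_iff[OF \<beta> L(1)] IL by (auto simp: T_def I_def)
  have detB: "Determinant.det B \<noteq> 0"
  proof
    assume "Determinant.det B = 0"
    then obtain y where y: "y \<in> carrier_vec J" "y \<noteq> 0\<^sub>v J" "B *\<^sub>v y = 0\<^sub>v J"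
      using det_0_iff_vec_prod_zero_field[OF B] by blast
    \<comment> \<open>The row of \<open>B\<close> at the reflected position \<open>t'\<close> is a
      nonzero multiple of column \<open>t\<close> of \<open>A\<close>, so a kernel vector of
      \<open>B\<close> is a relation between the rows of \<open>A\<close>.\<close>
    have "(\<Sum>c<J. A $$ (c, t) * y $ c) = 0" if t: "t < J" for t
    proof -
      have "L - pick I t \<in> pick I ` {..<J}"
        using pickI[OF t] diff_mem_unit_indices[of "pick I t" L] bij by (simp add: I_def bij_betw_def)
      then obtain t' where t': "t' < J" "pick I t' = L - pick I t"
        by auto
      have "pick I t < L"
        using pickI[OF t] IL by auto
      hence reflect: "L - pick I t' = pick I t"
        using t'(2) by simp
      have "0 = (B *\<^sub>v y) $ t'"
        using t'(1) y(3) by simp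
      also have "\<dots> = (\<Sum>c<J. B $$ (t', c) * y $ c)"
        using t'(1) B y(1) by (simp add: scalar_prod_def lessThan_atLeast0)
      also have "\<dots> = of_nat L * poly T (\<beta> ^ pick I t') * (\<Sum>c<J. A $$ (c, t) * y $ c)"
        using t'(1) t by (simp add: B_def A_index reflect sum_distrib_left mult.assoc)
      finally show ?thesis
        using L0 T0[OF pickI[OF t'(1)]] by simp
    qed
    hence "y $ c = 0" if "c < J" for c
      by (rule det_nonzero_row_combination[OF A detA _ that])
    hence "y = 0\<^sub>v J"
      using y(1) by (intro eq_vecI) auto
    with y(2) show False ..
  qed
  have Gc: "G \<in> carrier_mat J L"
  proof -
    have "map_mat \<iota> G \<in> carrier_mat J L"
      unfolding G using U vandermonde_neg_carrier by (rule mult_carrier_mat)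
    thus ?thesis
      by simp
  qed
  have C: "cyclic_perm_mat L \<in> carrier_mat L L"
    using L(1) by (rule cyclic_perm_mat_carrier)
  define Q where "Q = poly_mat (tau \<iota> L \<beta>) (cyclic_perm_mat L) * transpose_mat G"
  have Qc: "Q \<in> carrier_mat L J"
    unfolding Q_def by (rule mult_carrier_mat[OF poly_mat_carrier[OF C]]) (use Gc in simp)
  have factor: "map_mat \<iota> (G * cyclic_perm_mat L ^\<^sub>m l * Q) =
      A * mat_diag J (\<lambda>t. (\<beta> ^ pick I t) ^ l) * B" for l
  proof (rule eq_matI)
    have carr: "G * cyclic_perm_mat L ^\<^sub>m l * Q \<in> carrier_mat J J"
      by (intro mult_carrier_mat[of _ J L] Gc Qc pow_carrier_mat C)
    have AD: "A * mat_diag J (\<lambda>t. (\<beta> ^ pick I t) ^ l) \<in> carrier_mat J J"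
      by (rule mult_carrier_mat[OF A mat_diag_dim])
    fix r c
    assume "r < dim_row (A * mat_diag J (\<lambda>t. (\<beta> ^ pick I t) ^ l) * B)"
      "c < dim_col (A * mat_diag J (\<lambda>t. (\<beta> ^ pick I t) ^ l) * B)"
    hence rc: "r < J" "c < J"
      using A B by simp_all
    have "map_mat \<iota> (G * cyclic_perm_mat L ^\<^sub>m l * Q) $$ (r, c) =
        (\<Sum>j\<in>I. U $$ (r, j) * (\<beta> ^ j) ^ l * (of_nat L * poly T (\<beta> ^ j) * U $$ (c, L - j)))"
      unfolding Q_def I_def T_def
      by (rule block_index[OF hom L(1) \<beta> U G map_poly_tau[OF hom q \<beta> L] rc])
    also have "\<dots> = (\<Sum>t<J. U $$ (r, pick I t) * (\<beta> ^ pick I t) ^ l *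
        (of_nat L * poly T (\<beta> ^ pick I t) * U $$ (c, L - pick I t)))"
      by (rule sum.reindex_bij_betw[OF bij, symmetric])
    also have "\<dots> = (\<Sum>t<J. (A * mat_diag J (\<lambda>t. (\<beta> ^ pick I t) ^ l)) $$ (r, t) * B $$ (t, c))"
      unfolding mat_diag_mult_right[OF A] using rc by (simp add: A_index B_def)
    also have "\<dots> = (A * mat_diag J (\<lambda>t. (\<beta> ^ pick I t) ^ l) * B) $$ (r, c)"
      by (rule index_mult_mat_sum[OF AD B rc, symmetric])
    finally show "map_mat \<iota> (G * cyclic_perm_mat L ^\<^sub>m l * Q) $$ (r, c) =
        (A * mat_diag J (\<lambda>t. (\<beta> ^ pick I t) ^ l) * B) $$ (r, c)" .
  qed (use Gc Qc A B in simp_all)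
  have "factored_blocks \<iota> q J L G Q A B (\<lambda>t. \<beta> ^ pick I t)"
    by (rule factored_blocks.intro[OF hom q L(1) Gc Qc A detA B detB factor])
  thus ?thesis
    using that unfolding Q_def I_def by blast
qed

theorem theorem9:
  fixes q L J k n :: nat
    and \<iota> :: "'f::{field, finite} \<Rightarrow> 'e::{field, finite}"
    and \<beta> :: 'e
    and U U' :: "'e mat"
    and G H P Q :: "'f mat"
  assumes q: "prime q" "CARD('f) = q"
    and L: "0 < L" "coprime q L"
    and ext: "CARD('e) = q ^ ord L q" "field_hom \<iota>"
    and J: "J = card (unit_indices L)"
    and \<beta>: "is_primitive_root_of_unity L \<beta>"
    and U: "U \<in> carrier_mat J L" "U' \<in> carrier_mat J L"
    and rank_U: "mat_rank (submatrix U UNIV (unit_indices L)) = J"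
    and U'_eq: "transpose_mat (submatrix U' UNIV (unit_indices L)) =
          inverse (of_nat L) \<cdot>\<^sub>m the (mat_inverse (submatrix U UNIV (unit_indices L)))"
    and zero: "submatrix U UNIV ({..<L} - unit_indices L) = 0\<^sub>m J (L - J) \<or>
          submatrix U' UNIV ({..<L} - unit_indices L) = 0\<^sub>m J (L - J)"
    and G: "map_mat \<iota> G = U * vandermonde_neg L \<beta>"
    and H: "map_mat \<iota> H = vandermonde L \<beta> * transpose_mat U'"
    and P: "P = G"
    and Q: "Q = poly_mat (tau \<iota> L \<beta>) (cyclic_perm_mat L) * transpose_mat G"
    and kn: "1 \<le> k" "k \<le> n" "n \<le> ord L q" "ord L q \<le> J"
  shows "(\<forall>l. (\<forall>i<n. l i \<le> L - 1) \<and> inj_on l {..<n} \<and> full_rank_combinations n P Q l \<longrightarrow>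
            cs_code q k n P Q l \<subseteq> carrier_mat J n \<and>
            card (cs_code q k n P Q l) = q ^ (J * k) \<and>
            has_min_rank_dist (cs_code q k n P Q l) (n - k + 1) \<and>
            is_MRD J n (cs_code q k n P Q l) (n - k + 1)) \<and>
         (\<forall>c \<le> L - 1. full_rank_combinations n P Q (\<lambda>j. (j + c) mod L))"
proof -
  define I where "I = unit_indices L"
  have Lq: "coprime L q" and L1: "0 < L"
    using L by (simp_all add: coprime_commute)
  obtain A B where "factored_blocks \<iota> q J L P Q A B (\<lambda>t. \<beta> ^ pick I t)"
    unfolding I_def P Q using factored_blocks_cyclic[OF ext(2) q L \<beta> J U(1) rank_U G] by blast
  then interpret factored_blocks \<iota> q J L P Q A B "\<lambda>t. \<beta> ^ pick I t" .
  \<comment> \<open>The chain \<open>1 \<le> k \<le> n \<le> ord L q \<le> J\<close> excludes the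
    empty index set, that is, \<open>L = 1\<close>.\<close>
  have J0: "0 < J" "n \<le> J"
    using kn by simp_all
  have "cs_code q k n P Q l \<subseteq> carrier_mat J n \<and> card (cs_code q k n P Q l) = q ^ (J * k) \<and>
      has_min_rank_dist (cs_code q k n P Q l) (n - k + 1) \<and>
      is_MRD J n (cs_code q k n P Q l) (n - k + 1)" if "full_rank_combinations n P Q l" for l
    using cs_code_subset[of k n l] card_cs_code[OF that kn(1,2)]
      has_min_rank_dist_cs_code[OF that kn(1,2) J0(1)] kn J0(2) q(2)
    by (simp add: is_MRD_def)
  moreover have "full_rank_combinations n P Q (\<lambda>j. (j + c) mod L)" for c
  proof (rule full_rank_combinations_consecutive)
    fix t assume "t < J"
    hence "pick I t \<in> unit_indices L"
      using pick_in_set_le[of t I] by (simp add: I_def J)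
    hence coprime: "coprime (pick I t) L"
      by (simp add: unit_indices_def)
    show "(\<beta> ^ pick I t) ^ L = 1"
      by (simp add: primitive_root_power_eq_1_iff[OF \<beta> L1] flip: power_mult)
    show "inj_on (\<lambda>s. (\<beta> ^ pick I t) ^ q ^ s) {..<n}"
    proof (rule inj_onI)
      fix s s' assume s: "s \<in> {..<n}" "s' \<in> {..<n}" "(\<beta> ^ pick I t) ^ q ^ s = (\<beta> ^ pick I t) ^ q ^ s'"
      \<comment> \<open>Equal powers of \<open>\<beta>\<close> have congruent exponents; the unit
        \<open>pick I t\<close> cancels, and powers of \<open>q\<close> below its order modulo
        \<open>L\<close> are distinct.\<close>
      hence "[pick I t * q ^ s = pick I t * q ^ s'] (mod L)"
        by (simp add: cong_def primitive_root_power_eq_iff[OF \<beta> L1] flip: power_mult)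
      hence "[q ^ s = q ^ s'] (mod L)"
        using cong_mult_lcancel_nat[OF coprime] by blast
      moreover have "inj_on (\<lambda>s. q ^ s mod L) {..<ord L q}"
        using Lq by (rule inj_power_mod)
      ultimately show "s = s'"
        using s(1,2) kn(3) by (auto simp: cong_def dest: inj_onD)
    qed
  qed
  ultimately show ?thesis
    by blast
qed

end
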